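(* Let $A\in\mathbb{C}^{n\times N}$, let $S\subset\{1,\dots,N\}$ with $|S|=k$ such that $A_S$ has full column rank. Let $X\in\mathbb{R}^{N\times L}$ have all rows outside $S$ equal to zero and $X^S=\Sigma\Phi$, where $\Sigma\in\mathbb{R}^{k\times k}$ is a diagonal matrix with positive diagonal entries and $\Phi\in\mathbb{R}^{k\times L}$ has independent standard normal entries. Define $$A_L=\sqrt2\,\frac{\Gamma((L+1)/2)}{\Gamma(L/2)},\qquad \gamma=\frac{A_L}{3\sqrt L+2\sqrt k}.$$ If $\|A_S^\dagger a_\ell\|_2<\gamma$ for all $\ell\notin S$, then with probability at least $$1-\exp(-L/8)-k\exp(-A_L^2/8)$$ $X$ is the unique solution of $\min_Z\|Z\|_{2,1}$ subject to $AZ=AX$.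
   Context: $a_\ell$ is the $\ell$-th column of $A$, $A_S$ the submatrix of columns indexed by $S$, $A_S^\dagger=(A_S^*A_S)^{-1}A_S^*$. For $X\in\mathbb{C}^{N\times L}$, $X^j$ is its $j$-th row, $X^S$ the rows indexed by $S$, and $\|X\|_{2,1}=\sum_j\|X^j\|_2$. $\Gamma$ is the Gamma function. *)

theory Defs
  imports "HOL-Probability.Probability"
begin

text \<open>Matrices are functions nat => nat => _ with explicit dimension bounds (0-based indices).
  A is n x N (columns a_l = (%i. A i l)), matrices X, Z are N x L.\<close>

definition full_col_rank_on :: "(nat \<Rightarrow> nat \<Rightarrow> complex) \<Rightarrow> nat \<Rightarrow> nat set \<Rightarrow> bool" where
  "full_col_rank_on A n S \<longleftrightarrow>
     (\<forall>c :: nat \<Rightarrow> complex. (\<forall>i<n. (\<Sum>j\<in>S. A i j * c j) = 0) \<longrightarrow> (\<forall>j\<in>S. c j = 0))"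

definition adjS_apply :: "(nat \<Rightarrow> nat \<Rightarrow> complex) \<Rightarrow> nat \<Rightarrow> nat set \<Rightarrow> (nat \<Rightarrow> complex) \<Rightarrow> nat \<Rightarrow> complex" where
  "adjS_apply A n S y = (\<lambda>j. if j \<in> S then (\<Sum>i<n. cnj (A i j) * y i) else 0)"

definition AS_apply :: "(nat \<Rightarrow> nat \<Rightarrow> complex) \<Rightarrow> nat set \<Rightarrow> (nat \<Rightarrow> complex) \<Rightarrow> nat \<Rightarrow> complex" where
  "AS_apply A S c = (\<lambda>i. \<Sum>m\<in>S. A i m * c m)"

definition gram_inv_apply :: "(nat \<Rightarrow> nat \<Rightarrow> complex) \<Rightarrow> nat \<Rightarrow> nat set \<Rightarrow> (nat \<Rightarrow> complex) \<Rightarrow> nat \<Rightarrow> complex" where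
  "gram_inv_apply A n S w = (THE c. (\<forall>j. j \<notin> S \<longrightarrow> c j = 0) \<and>
        (\<forall>j\<in>S. adjS_apply A n S (AS_apply A S c) j = w j))"

definition pinvS_apply :: "(nat \<Rightarrow> nat \<Rightarrow> complex) \<Rightarrow> nat \<Rightarrow> nat set \<Rightarrow> (nat \<Rightarrow> complex) \<Rightarrow> nat \<Rightarrow> complex" where
  "pinvS_apply A n S b = gram_inv_apply A n S (adjS_apply A n S b)"

definition norm2S :: "nat set \<Rightarrow> (nat \<Rightarrow> complex) \<Rightarrow> real" where
  "norm2S S c = sqrt (\<Sum>j\<in>S. (cmod (c j))\<^sup>2)"

definition norm21 :: "nat \<Rightarrow> nat \<Rightarrow> (nat \<Rightarrow> nat \<Rightarrow> complex) \<Rightarrow> real" where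
  "norm21 N L Z = (\<Sum>j<N. sqrt (\<Sum>l<L. (cmod (Z j l))\<^sup>2))"

definition mat_mult :: "(nat \<Rightarrow> nat \<Rightarrow> complex) \<Rightarrow> nat \<Rightarrow> (nat \<Rightarrow> nat \<Rightarrow> complex) \<Rightarrow> nat \<Rightarrow> nat \<Rightarrow> complex" where
  "mat_mult A N Z = (\<lambda>i l. \<Sum>j<N. A i j * Z j l)"

definition unique_l21_solution ::
  "(nat \<Rightarrow> nat \<Rightarrow> complex) \<Rightarrow> nat \<Rightarrow> nat \<Rightarrow> nat \<Rightarrow> (nat \<Rightarrow> nat \<Rightarrow> complex) \<Rightarrow> bool" where
  "unique_l21_solution A n N L X \<longleftrightarrow>
     (let feas = {Z. \<forall>i<n. \<forall>l<L. mat_mult A N Z i l = mat_mult A N X i l} in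
       (\<forall>Z\<in>feas. norm21 N L X \<le> norm21 N L Z) \<and>
       (\<forall>Z\<in>feas. norm21 N L Z \<le> norm21 N L X \<longrightarrow> (\<forall>j<N. \<forall>l<L. Z j l = X j l)))"

definition gauss_entries :: "nat set \<Rightarrow> nat \<Rightarrow> ((nat \<times> nat) \<Rightarrow> real) measure" where
  "gauss_entries S L = PiM (S \<times> {..<L}) (\<lambda>_. density lborel std_normal_density)"

definition X_of :: "nat set \<Rightarrow> (nat \<Rightarrow> real) \<Rightarrow> ((nat \<times> nat) \<Rightarrow> real) \<Rightarrow> nat \<Rightarrow> nat \<Rightarrow> complex" where
  "X_of S \<sigma> \<Phi> = (\<lambda>j l. if j \<in> S then complex_of_real (\<sigma> j * \<Phi> (j, l)) else 0)"

definition A_const :: "nat \<Rightarrow> real" where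
  "A_const L = sqrt 2 * Gamma ((real L + 1) / 2) / Gamma (real L / 2)"

end

theory Submission
  imports Defs
begin

text \<open>
  Let U be the matrix with rows \<open>\<Phi>\<^sub>j / \<parallel>\<Phi>\<^sub>j\<parallel>\<close>. If \<open>\<parallel>U\<^sup>T A\<^sub>S\<^sup>\<dagger> a\<^sub>m\<parallel> < 1\<close> for all \<open>m \<notin> S\<close>, then U is a dual
  certificate for X. Since \<open>A\<^sub>L \<le> \<surd>L\<close> by log-convexity of Gamma, it suffices that
  \<open>\<parallel>U\<parallel>\<^sup>2 \<le> 9 + 4 k / L\<close>, which fails with probability at most \<open>exp (- L / 8)\<close>: for a unit vector z,
  Jensen's inequality (the norm and the direction of a Gaussian vector are independent) bounds
  \<open>E exp (3/8 L \<langle>U\<^sub>j, z\<rangle>\<^sup>2)\<close> by \<open>E exp (3/8 g\<^sup>2) = 2\<close> with g standard normal, so \<open>\<parallel>U z\<parallel>\<^sup>2\<close> has a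
  Chernoff tail, and a union bound over at most \<open>9\<^sup>L\<close> directions, given by the integer points near
  the sphere of radius \<open>\<surd>L\<close>, controls the operator norm. Normalising the rows before bounding the
  operator norm is what avoids Gaussian comparison and concentration inequalities.
\<close>

section \<open>Dual certificates\<close>

lemma sum_cnj_mult_self_eq_0_iff:
  fixes e :: "nat \<Rightarrow> complex"
  shows "(\<Sum>i<n. cnj (e i) * e i) = 0 \<longleftrightarrow> (\<forall>i<n. e i = 0)"
proof -
  have "(\<Sum>i<n. cnj (e i) * e i) = complex_of_real (\<Sum>i<n. (cmod (e i))\<^sup>2)"
    by (simp add: complex_norm_square[symmetric] mult.commute del: of_real_power)
  then show ?thesis
    by (auto simp: sum_nonneg_eq_0_iff simp del: of_real_sum of_real_power)
qed

text \<open>Gram-Schmidt, one column at a time. The induction hypothesis serves twice, for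
  \<open>b\<close> with residual \<open>r\<close> and for the new column \<open>j0\<close> with
  residual \<open>e\<close>; removing from \<open>r\<close> its component along \<open>e\<close>
  makes it orthogonal to the new column as well.\<close>

lemma least_squares_exists:
  fixes A :: "nat \<Rightarrow> nat \<Rightarrow> complex"
  assumes "finite S"
  shows "\<exists>c :: nat \<Rightarrow> complex. \<forall>j\<in>S. (\<Sum>i<n. cnj (A i j) * (b i - (\<Sum>m\<in>S. A i m * c m))) = 0"
  using assms
proof (induction S arbitrary: b rule: finite_induct)
  case empty
  then show ?case by simp
next
  case (insert j0 S)
  obtain c where c: "\<And>j. j \<in> S \<Longrightarrow> (\<Sum>i<n. cnj (A i j) * (b i - (\<Sum>m\<in>S. A i m * c m))) = 0"
    using insert.IH by blast
  obtain d where d: "\<And>j. j \<in> S \<Longrightarrow> (\<Sum>i<n. cnj (A i j) * (A i j0 - (\<Sum>m\<in>S. A i m * d m))) = 0"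
    using insert.IH[of "\<lambda>i. A i j0"] by blast
  define r where "r = (\<lambda>i. b i - (\<Sum>m\<in>S. A i m * c m))"
  define e where "e = (\<lambda>i. A i j0 - (\<Sum>m\<in>S. A i m * d m))"
  \<comment> \<open>If \<open>e\<close> vanishes on the rows below \<open>n\<close>, numerator and
    denominator are both zero; then \<open>t = 0\<close> by the convention on division, and
    orthogonality to \<open>e\<close> is trivial.\<close>
  define t where "t = (\<Sum>i<n. cnj (e i) * r i) / (\<Sum>i<n. cnj (e i) * e i)"
  define c' where "c' = (\<lambda>m. if m = j0 then t else c m - t * d m)"
  have res: "b i - (\<Sum>m\<in>insert j0 S. A i m * c' m) = r i - t * e i" for i
  proof -
    have "(\<Sum>m\<in>S. A i m * c' m) = (\<Sum>m\<in>S. A i m * c m - t * (A i m * d m))"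
      using insert.hyps by (intro sum.cong) (auto simp: c'_def algebra_simps)
    also have "\<dots> = (\<Sum>m\<in>S. A i m * c m) - t * (\<Sum>m\<in>S. A i m * d m)"
      by (simp add: sum_subtractf sum_distrib_left)
    finally show ?thesis
      using insert.hyps by (simp add: r_def e_def c'_def algebra_simps)
  qed
  have orth: "(\<Sum>i<n. cnj (A i j) * (r i - t * e i)) = 0" if "j \<in> S" for j
  proof -
    have "(\<Sum>i<n. cnj (A i j) * (r i - t * e i))
        = (\<Sum>i<n. cnj (A i j) * r i) - t * (\<Sum>i<n. cnj (A i j) * e i)"
      by (simp add: sum_subtractf sum_distrib_left algebra_simps)
    then show ?thesis using c[OF that] d[OF that] by (simp add: r_def e_def)
  qed
  have ere: "(\<Sum>i<n. cnj (e i) * (r i - t * e i)) = 0"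
  proof -
    have "(\<Sum>i<n. cnj (e i) * (r i - t * e i))
        = (\<Sum>i<n. cnj (e i) * r i) - t * (\<Sum>i<n. cnj (e i) * e i)"
      by (simp add: sum_subtractf sum_distrib_left algebra_simps)
    then show ?thesis
      using sum_cnj_mult_self_eq_0_iff[of e n] by (cases "(\<Sum>i<n. cnj (e i) * e i) = 0") (auto simp: t_def)
  qed
  \<comment> \<open>Column \<open>j0\<close> is \<open>e\<close> plus a combination of the columns
    in \<open>S\<close>, and the new residual is orthogonal to all of these.\<close>
  have "(\<Sum>i<n. cnj (A i j0) * (r i - t * e i))
      = (\<Sum>i<n. (cnj (e i) + (\<Sum>m\<in>S. cnj (d m) * cnj (A i m))) * (r i - t * e i))"
    by (intro sum.cong) (auto simp: e_def mult.commute)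
  also have "\<dots> = (\<Sum>i<n. cnj (e i) * (r i - t * e i))
      + (\<Sum>i<n. \<Sum>m\<in>S. cnj (d m) * (cnj (A i m) * (r i - t * e i)))"
    by (simp only: distrib_right sum.distrib sum_distrib_right mult.assoc)
  also have "(\<Sum>i<n. \<Sum>m\<in>S. cnj (d m) * (cnj (A i m) * (r i - t * e i)))
      = (\<Sum>m\<in>S. cnj (d m) * (\<Sum>i<n. cnj (A i m) * (r i - t * e i)))"
    by (subst sum.swap) (simp add: sum_distrib_left)
  also have "\<dots> = 0" by (simp add: orth)
  finally have "(\<Sum>i<n. cnj (A i j0) * (r i - t * e i)) = 0" using ere by simp
  then show ?case
    unfolding res[symmetric] by (intro exI[of _ c']) (use orth res in auto)
qed

text \<open>Pairing the Gram equation with \<open>d\<close> itself shows that the combination of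
  columns with coefficients \<open>d\<close> has squared norm zero.\<close>

lemma gram_injective:
  assumes "full_col_rank_on A n S" "finite S"
    and "\<forall>j\<in>S. (\<Sum>i<n. cnj (A i j) * (\<Sum>m\<in>S. A i m * d m)) = 0"
  shows "\<forall>j\<in>S. d j = 0"
proof -
  define v where "v = (\<lambda>i. \<Sum>m\<in>S. A i m * d m)"
  have "cnj (v i) = (\<Sum>j\<in>S. cnj (d j) * cnj (A i j))" for i
    by (simp add: v_def mult.commute)
  then have "(\<Sum>i<n. cnj (v i) * v i) = (\<Sum>i<n. \<Sum>j\<in>S. cnj (d j) * (cnj (A i j) * v i))"
    by (simp add: sum_distrib_right mult.assoc)
  also have "\<dots> = (\<Sum>j\<in>S. cnj (d j) * (\<Sum>i<n. cnj (A i j) * v i))"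
    by (subst sum.swap) (simp add: sum_distrib_left)
  also have "\<dots> = 0" using assms(3) by (simp add: v_def)
  finally have "\<forall>i<n. v i = 0" by (simp add: sum_cnj_mult_self_eq_0_iff)
  then show ?thesis using assms(1) by (auto simp: full_col_rank_on_def v_def)
qed

text \<open>The definite description in \<open>gram_inv_apply\<close> is legitimate: a least-squares
  solution cut off outside \<open>S\<close> is a witness, and \<open>gram_injective\<close> with the
  support condition makes it the only one. Orthogonality of the residual is the form in which the
  pseudoinverse is used later.\<close>

lemma pinvS_apply_normal_equation:
  assumes rank: "full_col_rank_on A n S" and fin: "finite S"
  shows "\<forall>j\<in>S. (\<Sum>i<n. cnj (A i j) * (b i - (\<Sum>m\<in>S. A i m * pinvS_apply A n S b m))) = 0"
proof -
  obtain c0 where c0: "\<forall>j\<in>S. (\<Sum>i<n. cnj (A i j) * (b i - (\<Sum>m\<in>S. A i m * c0 m))) = 0"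
    using least_squares_exists[OF fin] by blast
  define c where "c = (\<lambda>j. if j \<in> S then c0 j else 0)"
  define P where "P = (\<lambda>c. (\<forall>j. j \<notin> S \<longrightarrow> c j = 0) \<and>
        (\<forall>j\<in>S. adjS_apply A n S (AS_apply A S c) j = adjS_apply A n S b j))"
  have eq: "adjS_apply A n S (AS_apply A S x) j = adjS_apply A n S b j \<longleftrightarrow>
     (\<Sum>i<n. cnj (A i j) * (b i - (\<Sum>m\<in>S. A i m * x m))) = 0" if "j \<in> S" for x j
    using that by (auto simp: adjS_apply_def AS_apply_def right_diff_distrib sum_subtractf)
  have Pc: "P c" using c0 by (auto simp: P_def eq c_def)
  have uniq: "x = c" if "P x" for x
  proof -
    have "\<forall>j\<in>S. (x j - c j) = 0"
    proof (rule gram_injective[OF rank fin], rule ballI)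
      fix j assume "j \<in> S"
      then have "adjS_apply A n S (AS_apply A S x) j = adjS_apply A n S (AS_apply A S c) j"
        using that Pc by (simp add: P_def)
      then show "(\<Sum>i<n. cnj (A i j) * (\<Sum>m\<in>S. A i m * (x m - c m))) = 0"
        using \<open>j \<in> S\<close> by (simp add: adjS_apply_def AS_apply_def right_diff_distrib sum_subtractf)
    qed
    then show ?thesis using that Pc by (fastforce simp: P_def)
  qed
  have "pinvS_apply A n S b = c"
    unfolding pinvS_apply_def gram_inv_apply_def
    using Pc uniq unfolding P_def by (intro the_equality) blast+
  with Pc show ?thesis by (auto simp: P_def eq)
qed

text \<open>Let \<open>d\<close> be the difference of the two sides. The kernel relation makes the
  combination of columns in \<open>S\<close> with coefficients \<open>d\<close> a combination of the
  residuals of the columns outside \<open>S\<close>. These are orthogonal to the columns in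
  \<open>S\<close>, so the Gram matrix kills \<open>d\<close>.\<close>

lemma kernel_rows_eq:
  assumes rank: "full_col_rank_on A n S" and fin: "finite S" and sub: "S \<subseteq> {..<N}"
    and ker: "\<And>i. i < n \<Longrightarrow> (\<Sum>j<N. A i j * h j) = 0" and "j \<in> S"
  shows "h j = - (\<Sum>m\<in>{..<N} - S. pinvS_apply A n S (\<lambda>i. A i m) j * h m)"
proof -
  let ?T = "{..<N} - S" and ?p = "\<lambda>m. pinvS_apply A n S (\<lambda>i. A i m)"
  define d where "d = (\<lambda>j. h j + (\<Sum>m\<in>?T. ?p m j * h m))"
  have "\<forall>j\<in>S. d j = 0"
  proof (rule gram_injective[OF rank fin], rule ballI)
    fix j assume "j \<in> S"
    have "(\<Sum>q\<in>S. A i q * d q) = - (\<Sum>m\<in>?T. (A i m - (\<Sum>q\<in>S. A i q * ?p m q)) * h m)" if "i < n" for i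
    proof -
      have "(\<Sum>q\<in>S. A i q * h q) + (\<Sum>m\<in>?T. A i m * h m) = 0"
        using ker[OF that] sub
        by (subst (asm) sum.subset_diff[of S]) (auto simp: add.commute)
      moreover have "(\<Sum>q\<in>S. A i q * (\<Sum>m\<in>?T. ?p m q * h m)) = (\<Sum>m\<in>?T. (\<Sum>q\<in>S. A i q * ?p m q) * h m)"
        by (simp only: sum_distrib_left sum_distrib_right mult.assoc) (rule sum.swap)
      ultimately show ?thesis
        by (simp add: d_def distrib_left sum.distrib left_diff_distrib sum_subtractf eq_neg_iff_add_eq_0)
    qed
    then have "(\<Sum>i<n. cnj (A i j) * (\<Sum>m\<in>S. A i m * d m))
       = (\<Sum>i<n. \<Sum>m\<in>?T. - (cnj (A i j) * (A i m - (\<Sum>q\<in>S. A i q * ?p m q)) * h m))"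
      by (simp add: sum_distrib_left sum_negf mult.assoc)
    also have "\<dots> = (\<Sum>m\<in>?T. - ((\<Sum>i<n. cnj (A i j) * (A i m - (\<Sum>q\<in>S. A i q * ?p m q))) * h m))"
      by (subst sum.swap) (simp only: sum_negf sum_distrib_right)
    also have "\<dots> = 0"
      using pinvS_apply_normal_equation[OF rank fin] \<open>j \<in> S\<close> by (intro sum.neutral) auto
    finally show "(\<Sum>i<n. cnj (A i j) * (\<Sum>m\<in>S. A i m * d m)) = 0" .
  qed
  then show ?thesis using \<open>j \<in> S\<close> by (auto simp: d_def eq_neg_iff_add_eq_0)
qed

section \<open>Row norms and optimality from a dual certificate\<close>

definition vnorm :: "nat \<Rightarrow> (nat \<Rightarrow> complex) \<Rightarrow> real" where
  "vnorm L x = sqrt (\<Sum>l<L. (cmod (x l))\<^sup>2)"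

lemma vnorm_nonneg: "vnorm L x \<ge> 0"
  by (simp add: vnorm_def sum_nonneg)

lemma vnorm_eq_0_iff: "vnorm L x = 0 \<longleftrightarrow> (\<forall>l<L. x l = 0)"
  by (auto simp: vnorm_def sum_nonneg_eq_0_iff)

lemma cmod_sum_mult_le:
  "cmod (\<Sum>l<L. x l * y l) \<le> vnorm L x * vnorm L y"
proof -
  have "cmod (\<Sum>l<L. x l * y l) \<le> (\<Sum>l<L. \<bar>cmod (x l)\<bar> * \<bar>cmod (y l)\<bar>)"
    by (rule order_trans[OF norm_sum]) (simp add: norm_mult)
  also have "\<dots> \<le> L2_set (\<lambda>l. cmod (x l)) {..<L} * L2_set (\<lambda>l. cmod (y l)) {..<L}"
    by (rule L2_set_mult_ineq)
  finally show ?thesis by (simp add: vnorm_def L2_set_def)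
qed

lemma norm21_eq_vnorm: "norm21 N L Z = (\<Sum>j<N. vnorm L (Z j))"
  by (simp add: norm21_def vnorm_def)

text \<open>\<open>U\<close> acts as a subgradient of the row norms at \<open>X\<close>. Moving by a
  kernel element \<open>H\<close> changes the norm on \<open>S\<close> by at least the real part of
  its pairing with \<open>U\<close>, and \<open>kernel_rows_eq\<close> turns that pairing into one
  over the rows outside \<open>S\<close>, with coefficient vectors of norm below 1. Nonzero rows
  there cost strictly more than is gained on \<open>S\<close>; if they vanish, so does
  \<open>H\<close>.\<close>

lemma unique_l21_solution_dual_certificate:
  fixes U :: "nat \<Rightarrow> nat \<Rightarrow> real"
  assumes rank: "full_col_rank_on A n S" and sub: "S \<subseteq> {..<N}"
    and X0: "\<And>j l. j \<notin> S \<Longrightarrow> X j l = 0"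
    and Ule: "\<And>j. j \<in> S \<Longrightarrow> (\<Sum>l<L. (U j l)\<^sup>2) \<le> 1"
    and UX: "\<And>j. j \<in> S \<Longrightarrow> (\<Sum>l<L. complex_of_real (U j l) * X j l) = complex_of_real (vnorm L (X j))"
    and dual: "\<And>m. m \<in> {..<N} - S \<Longrightarrow>
       vnorm L (\<lambda>l. \<Sum>j\<in>S. complex_of_real (U j l) * pinvS_apply A n S (\<lambda>i. A i m) j) < 1"
  shows "unique_l21_solution A n N L X"
proof -
  let ?T = "{..<N} - S" and ?p = "\<lambda>m. pinvS_apply A n S (\<lambda>i. A i m)"
  let ?V = "\<lambda>m l. \<Sum>j\<in>S. complex_of_real (U j l) * ?p m j"
  have fin: "finite S" using sub finite_subset by blast
  \<comment> \<open>A quantitative gap rather than mere optimality, so that equality of norms forces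
    every summand to vanish; \<open>ZS\<close> then recovers the rows in \<open>S\<close>.\<close>
  have key: "norm21 N L X + (\<Sum>m\<in>?T. (1 - vnorm L (?V m)) * vnorm L (Z m)) \<le> norm21 N L Z"
    and ZS: "\<And>j l. j \<in> S \<Longrightarrow> l < L \<Longrightarrow> Z j l - X j l = - (\<Sum>m\<in>?T. ?p m j * Z m l)"
    if feas: "\<forall>i<n. \<forall>l<L. mat_mult A N Z i l = mat_mult A N X i l" for Z
  proof -
    define H where "H = (\<lambda>j l. Z j l - X j l)"
    have HT: "H m l = Z m l" if "m \<in> ?T" for m l using that X0 by (simp add: H_def)
    have HS: "H j l = - (\<Sum>m\<in>?T. ?p m j * H m l)" if "j \<in> S" "l < L" for j l
    proof (rule kernel_rows_eq[OF rank fin sub _ that(1)])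
      fix i assume "i < n"
      then show "(\<Sum>j<N. A i j * H j l) = 0"
        using feas that by (simp add: H_def mat_mult_def right_diff_distrib sum_subtractf)
    qed
    show ZS: "Z j l - X j l = - (\<Sum>m\<in>?T. ?p m j * Z m l)" if "j \<in> S" "l < L" for j l
      using HS[OF that] HT by (simp add: H_def)
    \<comment> \<open>Subgradient inequality: the pairing of \<open>U j\<close> with
      \<open>Z j\<close> is at most the norm of \<open>Z j\<close>, while \<open>UX\<close> gives
      equality at \<open>X\<close>.\<close>
    have row: "vnorm L (X j) + Re (\<Sum>l<L. U j l * H j l) \<le> vnorm L (Z j)" if "j \<in> S" for j
    proof -
      have "vnorm L (X j) + Re (\<Sum>l<L. U j l * H j l) = Re (\<Sum>l<L. U j l * Z j l)"
        using arg_cong[OF UX[OF that], of Re] by (simp add: H_def right_diff_distrib sum_subtractf)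
      also have "\<dots> \<le> cmod (\<Sum>l<L. U j l * Z j l)" by (rule complex_Re_le_cmod)
      also have "\<dots> \<le> vnorm L (\<lambda>l. U j l) * vnorm L (Z j)" by (rule cmod_sum_mult_le)
      also have "\<dots> \<le> 1 * vnorm L (Z j)"
        using Ule[OF that] by (intro mult_right_mono vnorm_nonneg) (simp add: vnorm_def)
      finally show ?thesis by simp
    qed
    have "(\<Sum>j\<in>S. \<Sum>l<L. U j l * H j l) = (\<Sum>j\<in>S. \<Sum>l<L. - (\<Sum>m\<in>?T. U j l * ?p m j * Z m l))"
      using HT by (intro sum.cong refl) (simp add: HS sum_distrib_left mult.assoc)
    also have "\<dots> = - (\<Sum>j\<in>S. \<Sum>m\<in>?T. \<Sum>l<L. U j l * ?p m j * Z m l)"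
      unfolding sum_negf by (intro arg_cong[where f=uminus] sum.cong[OF refl, of S]) (rule sum.swap)
    also have "\<dots> = - (\<Sum>m\<in>?T. \<Sum>j\<in>S. \<Sum>l<L. U j l * ?p m j * Z m l)"
      by (intro arg_cong[where f=uminus]) (rule sum.swap)
    also have "\<dots> = - (\<Sum>m\<in>?T. \<Sum>l<L. ?V m l * Z m l)"
      unfolding sum_distrib_right
      by (intro arg_cong[where f=uminus] sum.cong[OF refl, of ?T]) (rule sum.swap)
    finally have eq: "(\<Sum>j\<in>S. \<Sum>l<L. U j l * H j l) = - (\<Sum>m\<in>?T. \<Sum>l<L. ?V m l * Z m l)" .
    have "Re (\<Sum>m\<in>?T. \<Sum>l<L. ?V m l * Z m l) \<le> cmod (\<Sum>m\<in>?T. \<Sum>l<L. ?V m l * Z m l)"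
      by (rule complex_Re_le_cmod)
    also have "\<dots> \<le> (\<Sum>m\<in>?T. vnorm L (?V m) * vnorm L (Z m))"
      by (rule order_trans[OF norm_sum sum_mono]) (rule cmod_sum_mult_le)
    finally have V: "- (\<Sum>m\<in>?T. vnorm L (?V m) * vnorm L (Z m)) \<le> Re (\<Sum>j\<in>S. \<Sum>l<L. U j l * H j l)"
      by (simp add: eq)
    have "norm21 N L X = (\<Sum>j\<in>S. vnorm L (X j))"
    proof -
      have "vnorm L (X j) = 0" if "j \<notin> S" for j using X0 that by (simp add: vnorm_def)
      then show ?thesis unfolding norm21_eq_vnorm using sub by (intro sum.mono_neutral_right) auto
    qed
    moreover have "norm21 N L Z = (\<Sum>j\<in>S. vnorm L (Z j)) + (\<Sum>m\<in>?T. vnorm L (Z m))"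
      unfolding norm21_eq_vnorm using sub by (subst sum.subset_diff[of S]) auto
    moreover have "(\<Sum>j\<in>S. vnorm L (X j)) + Re (\<Sum>j\<in>S. \<Sum>l<L. U j l * H j l) \<le> (\<Sum>j\<in>S. vnorm L (Z j))"
      unfolding Re_sum[of _ S] sum.distrib[symmetric] by (rule sum_mono) (rule row)
    ultimately show "norm21 N L X + (\<Sum>m\<in>?T. (1 - vnorm L (?V m)) * vnorm L (Z m)) \<le> norm21 N L Z"
      using V by (simp add: left_diff_distrib sum_subtractf)
  qed
  have pos: "0 \<le> (1 - vnorm L (?V m)) * vnorm L (Z m)" if "m \<in> ?T" for m Z
    using dual[OF that] by (intro mult_nonneg_nonneg vnorm_nonneg) auto
  show ?thesis
    unfolding unique_l21_solution_def Let_def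
  proof (intro conjI ballI impI allI)
    fix Z assume "Z \<in> {Z. \<forall>i<n. \<forall>l<L. mat_mult A N Z i l = mat_mult A N X i l}"
    then have feas: "\<forall>i<n. \<forall>l<L. mat_mult A N Z i l = mat_mult A N X i l" by simp
    have nn: "0 \<le> (\<Sum>m\<in>?T. (1 - vnorm L (?V m)) * vnorm L (Z m))" by (rule sum_nonneg) (rule pos)
    with key[OF feas] show "norm21 N L X \<le> norm21 N L Z" by linarith
    assume "norm21 N L Z \<le> norm21 N L X"
    with key[OF feas] have "(\<Sum>m\<in>?T. (1 - vnorm L (?V m)) * vnorm L (Z m)) \<le> 0" by linarith
    then have "(\<Sum>m\<in>?T. (1 - vnorm L (?V m)) * vnorm L (Z m)) = 0"
      using nn by (rule antisym)
    then have "\<forall>m\<in>?T. (1 - vnorm L (?V m)) * vnorm L (Z m) = 0"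
      by (subst (asm) sum_nonneg_eq_0_iff) (use pos in auto)
    then have ZT: "Z m l = 0" if "m \<in> ?T" "l < L" for m l
    proof -
      have "(1 - vnorm L (?V m)) * vnorm L (Z m) = 0" using that(1) \<open>\<forall>m\<in>?T. _\<close> by blast
      then show ?thesis using dual[OF that(1)] that by (auto simp: vnorm_eq_0_iff)
    qed
    fix j l assume "j < N" "l < L"
    show "Z j l = X j l"
    proof (cases "j \<in> S")
      case True
      have "(\<Sum>m\<in>?T. ?p m j * Z m l) = 0" using ZT \<open>l < L\<close> by (intro sum.neutral) auto
      then show ?thesis using ZS[OF feas True \<open>l < L\<close>] by simp
    next
      case False
      then show ?thesis using ZT X0 \<open>j < N\<close> \<open>l < L\<close> by simp
    qed
  qed
qed

section \<open>Gaussian product measures\<close>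

abbreviation gauss :: "real measure" where
  "gauss \<equiv> density lborel (\<lambda>x. ennreal (std_normal_density x))"

section \<open>One-dimensional Gaussian integrals\<close>

lemma nn_integral_normal_density: "\<sigma> > 0 \<Longrightarrow> (\<integral>\<^sup>+x. ennreal (normal_density \<mu> \<sigma> x) \<partial>lborel) = 1"
  by (simp add: nn_integral_eq_integral)

text \<open>Completing the square: the weight shifts the density to mean \<open>b\<close>, up to a
  constant factor.\<close>

lemma gauss_mgf: "(\<integral>\<^sup>+x. ennreal (exp (b * x)) \<partial>gauss) = ennreal (exp (b\<^sup>2 / 2))"
proof -
  have "(\<integral>\<^sup>+x. ennreal (exp (b * x)) \<partial>gauss)
      = (\<integral>\<^sup>+x. ennreal (exp (b\<^sup>2 / 2)) * ennreal (normal_density b 1 x) \<partial>lborel)"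
    by (subst nn_integral_density)
      (auto intro!: nn_integral_cong simp: normal_density_def ennreal_mult[symmetric] exp_add[symmetric]
        power2_eq_square field_simps)
  also have "\<dots> = ennreal (exp (b\<^sup>2 / 2))"
    by (subst nn_integral_cmult) (auto simp: nn_integral_normal_density)
  finally show ?thesis .
qed

text \<open>The weight changes the exponent \<open>- x\<^sup>2 / 2\<close> into
  \<open>- x\<^sup>2 / 8\<close>, that of a normal density with standard deviation 2; the
  normalising constants differ by the factor 2.\<close>

lemma gauss_exp_square: "(\<integral>\<^sup>+x. ennreal (exp (3 / 8 * x\<^sup>2)) \<partial>gauss) = 2"
proof -
  have [simp]: "sqrt 8 = 2 * sqrt 2" using real_sqrt_mult[of 4 2] by simp
  have "(\<integral>\<^sup>+x. ennreal (exp (3 / 8 * x\<^sup>2)) \<partial>gauss)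
      = (\<integral>\<^sup>+x. ennreal 2 * ennreal (normal_density 0 2 x) \<partial>lborel)"
    by (subst nn_integral_density)
      (auto intro!: nn_integral_cong simp: normal_density_def ennreal_mult[symmetric] exp_add[symmetric]
         real_sqrt_mult field_simps simp del: ennreal_numeral)
  also have "\<dots> = 2"
    by (subst nn_integral_cmult) (auto simp: nn_integral_normal_density)
  finally show ?thesis .
qed

text \<open>The exponential factor replaces the density at \<open>x\<close> by the density at
  \<open>x / \<beta>\<close>; a linear substitution undoes this at the price of the
  Jacobian.\<close>

lemma gauss_scaling:
  assumes f[measurable]: "f \<in> borel_measurable borel" and "\<beta> > 0"
  shows "(\<integral>\<^sup>+x. f x * ennreal (exp (- (1 / \<beta>\<^sup>2 - 1) / 2 * x\<^sup>2)) \<partial>gauss)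
       = ennreal \<beta> * (\<integral>\<^sup>+x. f (\<beta> * x) \<partial>gauss)"
proof -
  have "(\<integral>\<^sup>+x. f x * ennreal (exp (- (1 / \<beta>\<^sup>2 - 1) / 2 * x\<^sup>2)) \<partial>gauss)
     = (\<integral>\<^sup>+x. f x * ennreal (std_normal_density (x / \<beta>)) \<partial>lborel)"
  proof (subst nn_integral_density; (simp; fail)?)
    show "(\<integral>\<^sup>+x. ennreal (std_normal_density x) * (f x * ennreal (exp (- (1 / \<beta>\<^sup>2 - 1) / 2 * x\<^sup>2))) \<partial>lborel)
       = (\<integral>\<^sup>+x. f x * ennreal (std_normal_density (x / \<beta>)) \<partial>lborel)"
    proof (intro nn_integral_cong)
      fix x
      have "std_normal_density x * exp (- (1 / \<beta>\<^sup>2 - 1) / 2 * x\<^sup>2) = std_normal_density (x / \<beta>)"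
        using \<open>\<beta> > 0\<close> by (simp add: std_normal_density_def exp_add[symmetric] field_simps power_divide)
      then show "ennreal (std_normal_density x) * (f x * ennreal (exp (- (1 / \<beta>\<^sup>2 - 1) / 2 * x\<^sup>2)))
        = f x * ennreal (std_normal_density (x / \<beta>))"
        by (metis ennreal_mult mult.left_commute normal_density_nonneg exp_ge_zero)
    qed
  qed
  also have "\<dots> = ennreal \<beta> * (\<integral>\<^sup>+x. f (\<beta> * x) * ennreal (std_normal_density x) \<partial>lborel)"
    using \<open>\<beta> > 0\<close> by (subst nn_integral_real_affine[where t=0 and c=\<beta>]) auto
  also have "\<dots> = ennreal \<beta> * (\<integral>\<^sup>+x. f (\<beta> * x) \<partial>gauss)"
    by (subst nn_integral_density) (auto simp: mult.commute)
  finally show ?thesis .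
qed

section \<open>Scaling and degree-0 homogeneity under the Gaussian product measure\<close>

lemma sets_PiM_gauss [measurable_cong]: "sets (PiM I (\<lambda>_. gauss)) = sets (PiM I (\<lambda>_. borel))"
  by (rule sets_PiM_cong) auto

lemma prob_space_gauss: "prob_space gauss"
  by (rule prob_space_normal_density) simp

lemma product_sigma_finite_gauss: "product_sigma_finite (\<lambda>_. gauss)"
  using prob_space_gauss by (simp add: product_sigma_finite_def prob_space_imp_sigma_finite)

text \<open>\<open>gauss_scaling\<close> in every coordinate, by Fubini and induction. For
  \<open>f\<close> invariant under positive scaling the right side is a multiple of the plain
  integral of \<open>f\<close>, which is how the identity is used.\<close>

lemma PiM_gauss_scaling:
  assumes "finite I" "f \<in> borel_measurable (PiM I (\<lambda>_. borel))" "\<beta> > 0"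
  shows "(\<integral>\<^sup>+x. f x * ennreal (exp (- (1 / \<beta>\<^sup>2 - 1) / 2 * (\<Sum>i\<in>I. (x i)\<^sup>2))) \<partial>PiM I (\<lambda>_. gauss))
       = ennreal (\<beta> ^ card I) * (\<integral>\<^sup>+x. f (\<lambda>i\<in>I. \<beta> * x i) \<partial>PiM I (\<lambda>_. gauss))"
  using assms(1,2)
proof (induction I arbitrary: f rule: finite_induct)
  case empty
  interpret product_sigma_finite "\<lambda>_. gauss" by (rule product_sigma_finite_gauss)
  interpret prob_space "PiM {} (\<lambda>_. gauss)" by (intro prob_space_PiM prob_space_gauss)
  show ?case by (simp add: nn_integral_empty restrict_def emeasure_space_1)
next
  case (insert i I)
  interpret product_sigma_finite "\<lambda>_. gauss" by (rule product_sigma_finite_gauss)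
  note insert.prems[measurable]
  let ?G = "PiM I (\<lambda>_. gauss)" and ?c = "- (1 / \<beta>\<^sup>2 - 1) / 2"
  interpret G: prob_space ?G by (intro prob_space_PiM prob_space_gauss)
  have [measurable]: "(\<lambda>p. (\<lambda>k\<in>I. \<beta> * snd p k)(i := fst p)) \<in> borel \<Otimes>\<^sub>M PiM I (\<lambda>_. borel) \<rightarrow>\<^sub>M PiM (insert i I) (\<lambda>_. borel)"
    by (rule measurable_fun_upd[where J=I]) measurable
  have "(\<lambda>p. f ((\<lambda>k\<in>I. \<beta> * snd p k)(i := fst p))) \<in> borel_measurable (borel \<Otimes>\<^sub>M ?G)"
    by measurable
  then have [measurable]: "(\<lambda>y. \<integral>\<^sup>+x. f ((\<lambda>k\<in>I. \<beta> * x k)(i := y)) \<partial>?G) \<in> borel_measurable borel"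
    by (intro G.borel_measurable_nn_integral) (simp add: case_prod_beta')
  have "(\<integral>\<^sup>+x. f x * ennreal (exp (?c * (\<Sum>i\<in>insert i I. (x i)\<^sup>2))) \<partial>PiM (insert i I) (\<lambda>_. gauss))
     = (\<integral>\<^sup>+y. \<integral>\<^sup>+x. f (x(i := y)) * ennreal (exp (?c * (\<Sum>k\<in>insert i I. ((x(i:=y)) k)\<^sup>2))) \<partial>?G \<partial>gauss)"
    using insert.hyps by (subst product_nn_integral_insert_rev) auto
  also have "\<dots> = (\<integral>\<^sup>+y. (\<integral>\<^sup>+x. f (x(i := y)) * ennreal (exp (?c * (\<Sum>i\<in>I. (x i)\<^sup>2))) \<partial>?G) * ennreal (exp (?c * y\<^sup>2)) \<partial>gauss)"
  proof (intro nn_integral_cong)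
    fix y :: real
    have "(\<Sum>k\<in>insert i I. ((x(i:=y)) k)\<^sup>2) = y\<^sup>2 + (\<Sum>i\<in>I. (x i)\<^sup>2)" for x
    proof -
      have "(\<Sum>k\<in>I. ((x(i:=y)) k)\<^sup>2) = (\<Sum>i\<in>I. (x i)\<^sup>2)"
        using insert.hyps by (intro sum.cong) auto
      then show ?thesis using insert.hyps by simp
    qed
    then have "ennreal (exp (?c * (\<Sum>k\<in>insert i I. ((x(i:=y)) k)\<^sup>2)))
       = ennreal (exp (?c * (\<Sum>i\<in>I. (x i)\<^sup>2))) * ennreal (exp (?c * y\<^sup>2))" for x
      by (simp add: ennreal_mult[symmetric] exp_add[symmetric] distrib_left add.commute)
    then show "(\<integral>\<^sup>+x. f (x(i := y)) * ennreal (exp (?c * (\<Sum>k\<in>insert i I. ((x(i:=y)) k)\<^sup>2))) \<partial>?G)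
       = (\<integral>\<^sup>+x. f (x(i := y)) * ennreal (exp (?c * (\<Sum>i\<in>I. (x i)\<^sup>2))) \<partial>?G) * ennreal (exp (?c * y\<^sup>2))"
      by (subst nn_integral_multc[symmetric]) (auto simp: mult.assoc)
  qed
  \<comment> \<open>The coordinates in \<open>I\<close> are rescaled by the induction hypothesis
    with \<open>y\<close> held fixed; \<open>gauss_scaling\<close> then handles the remaining
    one.\<close>
  also have "\<dots> = (\<integral>\<^sup>+y. (ennreal (\<beta> ^ card I) * (\<integral>\<^sup>+x. f ((\<lambda>i\<in>I. \<beta> * x i)(i := y)) \<partial>?G)) * ennreal (exp (?c * y\<^sup>2)) \<partial>gauss)"
    by (subst insert.IH) auto
  also have "\<dots> = ennreal \<beta> * (\<integral>\<^sup>+y. ennreal (\<beta> ^ card I) * (\<integral>\<^sup>+x. f ((\<lambda>i\<in>I. \<beta> * x i)(i := \<beta> * y)) \<partial>?G) \<partial>gauss)"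
    using \<open>\<beta> > 0\<close> by (subst gauss_scaling) measurable
  also have "\<dots> = ennreal (\<beta> ^ card (insert i I)) * (\<integral>\<^sup>+y. \<integral>\<^sup>+x. f ((\<lambda>i\<in>I. \<beta> * x i)(i := \<beta> * y)) \<partial>?G \<partial>gauss)"
    using insert.hyps \<open>\<beta> > 0\<close>
    by (subst nn_integral_cmult, measurable) (simp add: ennreal_mult mult.assoc)
  also have "(\<integral>\<^sup>+y. \<integral>\<^sup>+x. f ((\<lambda>i\<in>I. \<beta> * x i)(i := \<beta> * y)) \<partial>?G \<partial>gauss)
     = (\<integral>\<^sup>+x. f (\<lambda>i\<in>insert i I. \<beta> * x i) \<partial>PiM (insert i I) (\<lambda>_. gauss))"
  proof -
    have "(\<lambda>k\<in>I. \<beta> * x k)(i := \<beta> * y) = (\<lambda>k\<in>insert i I. \<beta> * (x(i:=y)) k)" for x y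
      using insert.hyps by (auto simp: fun_eq_iff)
    then show ?thesis
      using insert.hyps by (subst product_nn_integral_insert_rev) auto
  qed
  finally show ?case .
qed

text \<open>Equality holds, by independence of norm and direction. This inequality is all Jensen needs, and
  it follows from scaling alone: integrate \<open>1 \<le> exp (- c W) + c W\<close> against q and let c tend to 0.\<close>
lemma PiM_gauss_degree_0_sum_squares:
  fixes q :: "('i \<Rightarrow> real) \<Rightarrow> real"
  assumes "finite I" and q[measurable]: "q \<in> borel_measurable (PiM I (\<lambda>_. borel))"
    and q_nonneg: "\<And>x. 0 \<le> q x" and q_le: "\<And>x. q x \<le> C"
    and hom: "\<And>x \<beta>. \<beta> > 0 \<Longrightarrow> q (\<lambda>i\<in>I. \<beta> * x i) = q x"
  shows "of_nat (card I) * (\<integral>\<^sup>+x. ennreal (q x) \<partial>PiM I (\<lambda>_. gauss))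
      \<le> (\<integral>\<^sup>+x. ennreal (q x * (\<Sum>i\<in>I. (x i)\<^sup>2)) \<partial>PiM I (\<lambda>_. gauss))"
proof -
  let ?G = "PiM I (\<lambda>_. gauss)" and ?W = "\<lambda>x :: _ \<Rightarrow> real. \<Sum>i\<in>I. (x i)\<^sup>2"
  let ?Q = "\<integral>\<^sup>+x. ennreal (q x) \<partial>?G" and ?R = "\<integral>\<^sup>+x. ennreal (q x * ?W x) \<partial>?G"
  interpret prob_space ?G by (intro prob_space_PiM prob_space_gauss)
  \<comment> \<open>The parameter is \<open>c = (1 / \<beta>\<^sup>2 - 1) / 2\<close>, so that
    \<open>PiM_gauss_scaling\<close> evaluates the exponential term. It is nonnegative for
    \<open>\<beta> < 1\<close> and tends to 0 as \<beta> tends to 1.\<close>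
  have step: "?Q \<le> ennreal (\<beta> ^ card I) * ?Q + ennreal ((1 / \<beta>\<^sup>2 - 1) / 2) * ?R" if \<beta>: "0 < \<beta>" "\<beta> < 1" for \<beta>
  proof -
    define c where "c = (1 / \<beta>\<^sup>2 - 1) / 2"
    have "c \<ge> 0" using \<beta> by (simp add: c_def power_le_one)
    have "?Q \<le> (\<integral>\<^sup>+x. ennreal (q x) * ennreal (exp (- c * ?W x)) + ennreal c * ennreal (q x * ?W x) \<partial>?G)"
    proof (intro nn_integral_mono)
      fix x
      have W: "?W x \<ge> 0" by (simp add: sum_nonneg)
      have "1 \<le> exp (- c * ?W x) + c * ?W x" using exp_ge_add_one_self[of "- c * ?W x"] by simp
      then have "q x * 1 \<le> q x * (exp (- c * ?W x) + c * ?W x)" by (intro mult_left_mono q_nonneg)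
      then have "q x \<le> q x * exp (- c * ?W x) + c * (q x * ?W x)" by (simp add: algebra_simps)
      then have "ennreal (q x) \<le> ennreal (q x * exp (- c * ?W x) + c * (q x * ?W x))" by (rule ennreal_leI)
      also have "\<dots> = ennreal (q x) * ennreal (exp (- c * ?W x)) + ennreal c * ennreal (q x * ?W x)"
        using W q_nonneg \<open>c \<ge> 0\<close> by (simp add: ennreal_plus ennreal_mult)
      finally show "ennreal (q x) \<le> ennreal (q x) * ennreal (exp (- c * ?W x)) + ennreal c * ennreal (q x * ?W x)" .
    qed
    also have "\<dots> = (\<integral>\<^sup>+x. ennreal (q x) * ennreal (exp (- c * ?W x)) \<partial>?G) + ennreal c * ?R"
      by (subst nn_integral_add, simp, simp, subst nn_integral_cmult) auto
    also have "(\<integral>\<^sup>+x. ennreal (q x) * ennreal (exp (- c * ?W x)) \<partial>?G) = ennreal (\<beta> ^ card I) * ?Q"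
      using PiM_gauss_scaling[OF \<open>finite I\<close>, of "\<lambda>x. ennreal (q x)" \<beta>] \<beta> by (simp add: c_def hom minus_divide_left)
    finally show ?thesis by (simp add: c_def)
  qed
  show ?thesis
  proof (cases "?R = \<top>")
    case True
    then show ?thesis by (metis top_greatest)
  next
    case False
    then obtain r where r: "?R = ennreal r" "r \<ge> 0" by (cases ?R) auto
    have "?Q \<le> (\<integral>\<^sup>+x. ennreal C \<partial>?G)" by (intro nn_integral_mono ennreal_leI q_le)
    also have "\<dots> < \<top>" by (simp add: emeasure_space_1)
    finally obtain p where p: "?Q = ennreal p" "p \<ge> 0" by (cases ?Q) auto
    \<comment> \<open>Both sides of \<open>step\<close>, after rearranging, carry a factor
      \<open>1 - \<beta>\<close>: on the left by a geometric sum, on the right by factoring, where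
      \<open>1 + \<beta> \<le> 2\<close>. Cancelling it leaves a bound that survives the
      limit.\<close>
    have le: "of_nat (card I) * \<beta> ^ (card I + 2) * p \<le> r" if \<beta>: "0 < \<beta>" "\<beta> < 1" for \<beta>
    proof -
      have "(1 / \<beta>\<^sup>2 - 1) / 2 \<ge> 0" using \<beta> by (simp add: power_le_one)
      then have "p \<le> \<beta> ^ card I * p + (1 / \<beta>\<^sup>2 - 1) / 2 * r"
        using step[OF \<beta>] \<beta> p(2) r(2) unfolding p(1) r(1)
        by (simp add: ennreal_mult[symmetric] ennreal_plus[symmetric] del: ennreal_plus)
      then have "(1 - \<beta> ^ card I) * p \<le> (1 / \<beta>\<^sup>2 - 1) / 2 * r" by (subst left_diff_distrib) linarith
      also have "(1 / \<beta>\<^sup>2 - 1) / 2 = (1 - \<beta>) * ((1 + \<beta>) / (2 * \<beta>\<^sup>2))"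
        using \<beta> by (simp add: field_simps power2_eq_square)
      also have "(1 - \<beta>) * ((1 + \<beta>) / (2 * \<beta>\<^sup>2)) * r \<le> (1 - \<beta>) * (1 / \<beta>\<^sup>2) * r"
        using \<beta> r by (intro mult_right_mono mult_left_mono) (auto simp: field_simps)
      finally have "(1 - \<beta> ^ card I) * p \<le> (1 - \<beta>) * (1 / \<beta>\<^sup>2) * r" .
      moreover have "(1 - \<beta>) * (of_nat (card I) * \<beta> ^ card I) \<le> 1 - \<beta> ^ card I"
      proof -
        have "of_nat (card I) * \<beta> ^ card I = (\<Sum>i<card I. \<beta> ^ card I)" by simp
        also have "\<dots> \<le> (\<Sum>i<card I. \<beta> ^ i)"
          using \<beta> by (intro sum_mono power_decreasing) auto
        finally have "(1 - \<beta>) * (of_nat (card I) * \<beta> ^ card I) \<le> (1 - \<beta>) * (\<Sum>i<card I. \<beta> ^ i)"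
          using \<beta> by (intro mult_left_mono) auto
        also have "\<dots> = 1 - \<beta> ^ card I" by (simp add: one_diff_power_eq)
        finally show ?thesis .
      qed
      ultimately have "(1 - \<beta>) * (of_nat (card I) * \<beta> ^ card I) * p \<le> (1 - \<beta>) * (1 / \<beta>\<^sup>2) * r"
        using p(2) by (meson mult_right_mono order_trans)
      then have "(1 - \<beta>) * (of_nat (card I) * \<beta> ^ card I * p) \<le> (1 - \<beta>) * (1 / \<beta>\<^sup>2 * r)"
        by (simp only: mult.assoc)
      then have "of_nat (card I) * \<beta> ^ card I * p \<le> 1 / \<beta>\<^sup>2 * r"
        by (rule mult_left_le_imp_le) (use \<beta> in simp)
      then show ?thesis using \<beta> by (simp add: field_simps power_add power2_eq_square)
    qed
    have "((\<lambda>\<beta>. of_nat (card I) * \<beta> ^ (card I + 2) * p) \<longlongrightarrow> of_nat (card I) * 1 ^ (card I + 2) * p) (at_left (1::real))"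
      by (intro tendsto_intros)
    moreover have "\<forall>\<^sub>F \<beta> in at_left (1::real). of_nat (card I) * \<beta> ^ (card I + 2) * p \<le> r"
      using eventually_at_left_real[OF zero_less_one] by (rule eventually_mono) (rule le, auto)
    ultimately have "of_nat (card I) * p \<le> r"
      using tendsto_upperbound trivial_limit_at_left_real by fastforce
    then show ?thesis using p r
      by (simp add: ennreal_of_nat_eq_real_of_nat ennreal_mult[symmetric])
  qed
qed

section \<open>Exponential moments of linear forms, plain and normalised\<close>

lemma nn_integral_exp_linear_PiM:
  assumes "finite I"
  shows "(\<integral>\<^sup>+x. ennreal (exp (\<Sum>i\<in>I. b i * x i)) \<partial>PiM I (\<lambda>_. gauss)) = ennreal (exp ((\<Sum>i\<in>I. (b i)\<^sup>2) / 2))"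
proof -
  interpret product_sigma_finite "\<lambda>_. gauss" by (rule product_sigma_finite_gauss)
  have "(\<integral>\<^sup>+x. ennreal (exp (\<Sum>i\<in>I. b i * x i)) \<partial>PiM I (\<lambda>_. gauss))
      = (\<integral>\<^sup>+x. (\<Prod>i\<in>I. ennreal (exp (b i * x i))) \<partial>PiM I (\<lambda>_. gauss))"
    using assms by (simp add: exp_sum prod_ennreal)
  also have "\<dots> = (\<Prod>i\<in>I. ennreal (exp ((b i)\<^sup>2 / 2)))"
    using assms by (subst product_nn_integral_prod) (auto simp: gauss_mgf)
  also have "\<dots> = ennreal (exp ((\<Sum>i\<in>I. (b i)\<^sup>2) / 2))"
    using assms by (simp add: exp_sum prod_ennreal sum_divide_distrib)
  finally show ?thesis .
qed

text \<open>An auxiliary Gaussian variable \<open>t\<close> linearises the square: since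
  \<open>(sqrt 3 / 2)\<^sup>2 / 2 = 3 / 8\<close>, \<open>gauss_mgf\<close> writes the integrand as
  a mean of exponentials linear in \<open>x\<close>. After swapping the integrals \<open>z\<close>
  enters only through its norm. This takes the place of rotation invariance.\<close>

lemma PiM_gauss_exp_square:
  assumes "finite I" "(\<Sum>i\<in>I. (z i)\<^sup>2) = 1"
  shows "(\<integral>\<^sup>+x. ennreal (exp (3 / 8 * (\<Sum>i\<in>I. z i * x i)\<^sup>2)) \<partial>PiM I (\<lambda>_. gauss)) = 2"
proof -
  let ?G = "PiM I (\<lambda>_. gauss)" and ?c = "sqrt 3 / 2"
  interpret G: prob_space ?G by (intro prob_space_PiM prob_space_gauss)
  interpret g: prob_space gauss by (rule prob_space_gauss)
  interpret pair_sigma_finite ?G gauss ..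
  have "(\<integral>\<^sup>+x. ennreal (exp (3 / 8 * (\<Sum>i\<in>I. z i * x i)\<^sup>2)) \<partial>?G)
     = (\<integral>\<^sup>+x. \<integral>\<^sup>+t. ennreal (exp (?c * (\<Sum>i\<in>I. z i * x i) * t)) \<partial>gauss \<partial>?G)"
    by (subst gauss_mgf) (simp add: power_mult_distrib power_divide)
  also have "\<dots> = (\<integral>\<^sup>+t. \<integral>\<^sup>+x. ennreal (exp (?c * (\<Sum>i\<in>I. z i * x i) * t)) \<partial>?G \<partial>gauss)"
    by (rule Fubini'[symmetric]) measurable
  also have "\<dots> = (\<integral>\<^sup>+t. ennreal (exp (3 / 8 * t\<^sup>2)) \<partial>gauss)"
  proof (intro nn_integral_cong)
    fix t
    have "?c * (\<Sum>i\<in>I. z i * x i) * t = (\<Sum>i\<in>I. (?c * t * z i) * x i)" for x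
      by (simp add: sum_distrib_left sum_distrib_right mult_ac)
    moreover have "(\<Sum>i\<in>I. (?c * t * z i)\<^sup>2) / 2 = 3 / 8 * t\<^sup>2"
      using assms(2) by (simp add: power_mult_distrib power_divide sum_distrib_left[symmetric] sum_divide_distrib[symmetric])
    ultimately show "(\<integral>\<^sup>+x. ennreal (exp (?c * (\<Sum>i\<in>I. z i * x i) * t)) \<partial>?G) = ennreal (exp (3 / 8 * t\<^sup>2))"
      using nn_integral_exp_linear_PiM[OF assms(1)] by presburger
  qed
  also have "\<dots> = 2" by (rule gauss_exp_square)
  finally show ?thesis .
qed

text \<open>Jensen's inequality in pointwise form. With \<open>r\<close> the squared cosine between
  \<open>z\<close> and \<open>x\<close>, the tangent to exp at \<open>3 / 8 * L * r x\<close> bounds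
  \<open>exp (3 / 8 * r x * ?W x)\<close> from below by \<open>h x + q x * (?W x - L)\<close>. Since
  \<open>q\<close> is bounded and homogeneous of degree 0,
  \<open>PiM_gauss_degree_0_sum_squares\<close> lets the \<open>q\<close> terms be dropped after
  integration.\<close>

lemma PiM_gauss_normalized_mgf:
  assumes "finite I" and z: "(\<Sum>i\<in>I. (z i)\<^sup>2) = 1"
  shows "(\<integral>\<^sup>+x. ennreal (exp (3 / 8 * card I * ((\<Sum>i\<in>I. z i * x i)\<^sup>2 / (\<Sum>i\<in>I. (x i)\<^sup>2)))) \<partial>PiM I (\<lambda>_. gauss)) \<le> 2"
proof -
  let ?G = "PiM I (\<lambda>_. gauss)" and ?W = "\<lambda>x :: _ \<Rightarrow> real. \<Sum>i\<in>I. (x i)\<^sup>2"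
  define L where "L = real (card I)"
  define r where "r = (\<lambda>x. (\<Sum>i\<in>I. z i * x i)\<^sup>2 / (\<Sum>i\<in>I. (x i)\<^sup>2))"
  define h where "h = (\<lambda>x. exp (3 / 8 * L * r x))"
  define q where "q = (\<lambda>x. 3 / 8 * r x * h x)"
  interpret prob_space ?G by (intro prob_space_PiM prob_space_gauss)
  have W: "?W x \<ge> 0" for x by (simp add: sum_nonneg)
  have cs: "(\<Sum>i\<in>I. z i * x i)\<^sup>2 \<le> ?W x" for x
    using Cauchy_Schwarz_ineq_sum[of z x I] z by simp
  \<comment> \<open>When \<open>?W x = 0\<close> the quotient is 0 by convention, and Cauchy-Schwarz
    makes the right side 0 as well.\<close>
  have rW: "r x * ?W x = (\<Sum>i\<in>I. z i * x i)\<^sup>2" for x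
    using cs[of x] W[of x] by (cases "?W x = 0") (auto simp: r_def)
  have r0: "0 \<le> r x" and r1: "r x \<le> 1" for x
    using cs[of x] W[of x] by (auto simp: r_def divide_le_eq_1)
  have L0: "L \<ge> 0" by (simp add: L_def)
  have h1: "h x \<le> exp (3 / 8 * L)" for x
    using r1[of x] L0 by (simp add: h_def mult_left_le)
  have h0: "0 \<le> h x" for x by (simp add: h_def)
  have q0: "0 \<le> q x" for x using r0 h0 by (simp add: q_def)
  have qle: "q x \<le> 3 / 8 * 1 * exp (3 / 8 * L)" for x
    unfolding q_def by (intro mult_mono h1 r1 h0 r0) auto
  have [measurable]: "r \<in> borel_measurable (PiM I (\<lambda>_. borel))" unfolding r_def by measurable
  have [measurable]: "h \<in> borel_measurable (PiM I (\<lambda>_. borel))" unfolding h_def by measurable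
  have [measurable]: "q \<in> borel_measurable (PiM I (\<lambda>_. borel))" unfolding q_def by measurable
  have "r (\<lambda>i\<in>I. \<beta> * x i) = r x" if "\<beta> > 0" for \<beta> x
  proof -
    have "(\<Sum>i\<in>I. z i * (\<lambda>i\<in>I. \<beta> * x i) i) = \<beta> * (\<Sum>i\<in>I. z i * x i)"
      by (simp add: sum_distrib_left mult_ac)
    moreover have "(\<Sum>i\<in>I. ((\<lambda>i\<in>I. \<beta> * x i) i)\<^sup>2) = \<beta>\<^sup>2 * (\<Sum>i\<in>I. (x i)\<^sup>2)"
      by (simp add: sum_distrib_left power_mult_distrib)
    ultimately show ?thesis using that unfolding r_def by (simp add: power_mult_distrib)
  qed
  then have hom: "q (\<lambda>i\<in>I. \<beta> * x i) = q x" if "\<beta> > 0" for \<beta> x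
    using that by (simp add: q_def h_def)
  let ?Q = "\<integral>\<^sup>+x. ennreal (q x) \<partial>?G"
  have "?Q \<le> (\<integral>\<^sup>+x. ennreal (3 / 8 * 1 * exp (3 / 8 * L)) \<partial>?G)"
    by (intro nn_integral_mono ennreal_leI qle)
  also have "\<dots> < \<top>" by (simp add: emeasure_space_1)
  \<comment> \<open>Finiteness permits cancelling the multiple of \<open>?Q\<close> from both sides
    in \<open>ennreal\<close>.\<close>
  finally have Qfin: "?Q \<noteq> \<top>" by simp
  have pt: "h x + q x * ?W x \<le> exp (3 / 8 * (\<Sum>i\<in>I. z i * x i)\<^sup>2) + L * q x" for x
  proof -
    have "h x * (1 + 3 / 8 * (r x * ?W x - L * r x)) \<le> h x * exp (3 / 8 * (r x * ?W x - L * r x))"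
      by (intro mult_left_mono h0 exp_ge_add_one_self)
    also have "\<dots> = exp (3 / 8 * (r x * ?W x))"
      by (simp add: h_def exp_add[symmetric] algebra_simps)
    finally show ?thesis unfolding rW[symmetric] q_def by (simp add: algebra_simps)
  qed
  have "(\<integral>\<^sup>+x. ennreal (h x) \<partial>?G) + of_nat (card I) * ?Q
      \<le> (\<integral>\<^sup>+x. ennreal (h x) \<partial>?G) + (\<integral>\<^sup>+x. ennreal (q x * ?W x) \<partial>?G)"
    by (intro add_left_mono PiM_gauss_degree_0_sum_squares[OF assms(1) _ q0 qle hom]) auto
  also have "\<dots> = (\<integral>\<^sup>+x. ennreal (h x + q x * ?W x) \<partial>?G)"
    using W h0 q0 by (subst nn_integral_add[symmetric]) (auto simp: ennreal_plus)
  also have "\<dots> \<le> (\<integral>\<^sup>+x. ennreal (exp (3 / 8 * (\<Sum>i\<in>I. z i * x i)\<^sup>2) + L * q x) \<partial>?G)"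
    by (intro nn_integral_mono ennreal_leI pt)
  also have "\<dots> = (\<integral>\<^sup>+x. ennreal (exp (3 / 8 * (\<Sum>i\<in>I. z i * x i)\<^sup>2)) + ennreal L * ennreal (q x) \<partial>?G)"
    using L0 q0 by (simp add: ennreal_plus ennreal_mult)
  also have "\<dots> = 2 + of_nat (card I) * ?Q"
    by (subst nn_integral_add, simp, simp, subst nn_integral_cmult, simp,
        subst PiM_gauss_exp_square[OF assms]) (simp add: L_def ennreal_of_nat_eq_real_of_nat)
  finally have "(\<integral>\<^sup>+x. ennreal (h x) \<partial>?G) \<le> 2"
    using Qfin by (simp add: ennreal_add_left_cancel_le ennreal_mult_eq_top_iff add.commute[of _ "of_nat (card I) * ?Q"])
  then show ?thesis by (simp add: h_def r_def L_def)
qed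

section \<open>Measurability of the recovery event\<close>

text \<open>The tube lemma: projection along a compact factor is a closed map.\<close>

lemma closed_projection_along_compact:
  fixes K :: "'a::topological_space set" and C :: "('a \<times> 'b::topological_space) set"
  assumes "compact K" "closed C"
  shows "closed {y. \<exists>x\<in>K. (x, y) \<in> C}"
proof -
  have "closed_map (prod_topology (top_of_set K) (euclidean :: 'b topology)) euclidean snd"
    using assms(1) by (intro closed_map_snd) (simp add: compact_space_subtopology)
  moreover have "closedin (prod_topology (top_of_set K) (euclidean :: 'b topology)) (C \<inter> K \<times> UNIV)"
  proof -
    have "prod_topology (top_of_set K) (euclidean :: 'b topology) = top_of_set (K \<times> UNIV)"
      by (simp add: prod_topology_subtopology(1))
    then show ?thesis using assms(2) by (simp add: closedin_closed_Int Int_commute[of C])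
  qed
  ultimately have "closedin euclidean (snd ` (C \<inter> K \<times> UNIV))" by (auto simp: closed_map_def)
  moreover have "snd ` (C \<inter> K \<times> UNIV) = {y. \<exists>x\<in>K. (x, y) \<in> C}" by force
  ultimately show ?thesis by simp
qed

text \<open>Tychonoff's theorem; choosing \<open>{0}\<close> in all but finitely many coordinates
  gives finite-dimensional boxes inside the function space.\<close>

lemma compact_Pi_UNIV:
  fixes C :: "'i \<Rightarrow> 'b::topological_space set"
  assumes "\<And>i. compact (C i)"
  shows "compact {x. \<forall>i. x i \<in> C i}"
proof -
  have "compactin (product_topology (\<lambda>i. euclidean) UNIV) (PiE UNIV C)"
    using assms by (simp add: compactin_PiE)
  moreover have "PiE UNIV C = {x. \<forall>i. x i \<in> C i}" by (auto simp: PiE_def Pi_def)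
  ultimately show ?thesis by (simp add: euclidean_product_topology)
qed

section \<open>Non-uniqueness as a measurable event\<close>

lemma norm21_cong: "(\<And>j l. j < N \<Longrightarrow> l < L \<Longrightarrow> X j l = Y j l) \<Longrightarrow> norm21 N L X = norm21 N L Y"
  by (simp add: norm21_def)

text \<open>By the uniqueness clause a strictly better competitor would agree with \<open>X\<close>
  entrywise and so have the same norm. Failure of either clause therefore comes down to one nonzero
  kernel direction, an existential form suited to projection arguments.\<close>

lemma not_unique_l21_solution_iff:
  "\<not> unique_l21_solution A n N L X \<longleftrightarrow>
   (\<exists>H. (\<forall>i<n. \<forall>l<L. mat_mult A N H i l = 0) \<and> (\<exists>j<N. \<exists>l<L. H j l \<noteq> 0) \<and>
      norm21 N L (\<lambda>j l. X j l + H j l) \<le> norm21 N L X)" (is "_ \<longleftrightarrow> (\<exists>H. ?B H)")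
proof -
  have mm: "mat_mult A N (\<lambda>j l. X j l + H j l) i l = mat_mult A N X i l + mat_mult A N H i l" for H i l
    by (simp add: mat_mult_def distrib_left sum.distrib)
  have "unique_l21_solution A n N L X" if no: "\<And>H. \<not> ?B H"
  proof -
    have eq: "\<forall>j<N. \<forall>l<L. Z j l = X j l"
      if "\<forall>i<n. \<forall>l<L. mat_mult A N Z i l = mat_mult A N X i l" "norm21 N L Z \<le> norm21 N L X" for Z
    proof -
      have "\<forall>i<n. \<forall>l<L. mat_mult A N (\<lambda>j l. Z j l - X j l) i l = 0"
        using that(1) mm[of "\<lambda>j l. Z j l - X j l"] by simp
      then show ?thesis using no[of "\<lambda>j l. Z j l - X j l"] that(2) by auto
    qed
    moreover have "norm21 N L X \<le> norm21 N L Z"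
      if "\<forall>i<n. \<forall>l<L. mat_mult A N Z i l = mat_mult A N X i l" for Z
    proof (rule ccontr)
      assume *: "\<not> norm21 N L X \<le> norm21 N L Z"
      then have "norm21 N L Z = norm21 N L X" by (intro norm21_cong) (use eq[OF that] in auto)
      with * show False by simp
    qed
    ultimately show ?thesis by (auto simp: unique_l21_solution_def Let_def)
  qed
  moreover have "\<not> unique_l21_solution A n N L X" if "?B H" for H
  proof
    assume "unique_l21_solution A n N L X"
    then have *: "\<forall>Z\<in>{Z. \<forall>i<n. \<forall>l<L. mat_mult A N Z i l = mat_mult A N X i l}.
        norm21 N L Z \<le> norm21 N L X \<longrightarrow> (\<forall>j<N. \<forall>l<L. Z j l = X j l)"
      unfolding unique_l21_solution_def Let_def by (rule conjunct2)
    have "(\<lambda>j l. X j l + H j l) \<in> {Z. \<forall>i<n. \<forall>l<L. mat_mult A N Z i l = mat_mult A N X i l}"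
      using that mm[of H] by simp
    from bspec[OF * this] that have "\<forall>j<N. \<forall>l<L. X j l + H j l = X j l" by simp
    then show False using that by auto
  qed
  ultimately show ?thesis by blast
qed

text \<open>The bad set is a countable union of projections, along compact sets of kernel
  elements, of closed sets.\<close>
lemma borel_non_unique:
  "{X :: nat \<times> nat \<Rightarrow> complex. \<not> unique_l21_solution A n N L (\<lambda>j l. X (j, l))} \<in> sets borel"
proof -
  \<comment> \<open>\<open>s\<close> measures the relevant block of entries. \<open>K m\<close>
    bounds these entries and fixes all others at 0, for compactness; \<open>D m\<close> replaces the
    open condition \<open>s H > 0\<close> by the closed one
    \<open>1 / Suc m \<le> s H\<close>.\<close>
  define s where "s = (\<lambda>H :: nat \<times> nat \<Rightarrow> complex. \<Sum>j<N. \<Sum>l<L. cmod (H (j, l)))"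
  define K where "K = (\<lambda>m::nat. {H :: nat \<times> nat \<Rightarrow> complex.
     \<forall>p. H p \<in> cball 0 (if p \<in> {..<N} \<times> {..<L} then real m else 0)})"
  define D where "D = (\<lambda>m::nat. {H. (\<forall>i<n. \<forall>l<L. (\<Sum>j<N. A i j * H (j, l)) = 0) \<and> 1 / Suc m \<le> s H})"
  define C where "C = {p :: (nat \<times> nat \<Rightarrow> complex) \<times> (nat \<times> nat \<Rightarrow> complex).
     norm21 N L (\<lambda>j l. snd p (j, l) + fst p (j, l)) \<le> norm21 N L (\<lambda>j l. snd p (j, l))}"
  have coord: "continuous_on UNIV (\<lambda>x :: nat \<times> nat \<Rightarrow> complex. x p)" for p by simp
  have coord1: "continuous_on UNIV (\<lambda>x :: (nat \<times> nat \<Rightarrow> complex) \<times> (nat \<times> nat \<Rightarrow> complex). fst x p)" for p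
    by (rule continuous_on_compose2[OF coord continuous_on_fst]) (auto intro: continuous_intros)
  have coord2: "continuous_on UNIV (\<lambda>x :: (nat \<times> nat \<Rightarrow> complex) \<times> (nat \<times> nat \<Rightarrow> complex). snd x p)" for p
    by (rule continuous_on_compose2[OF coord continuous_on_snd]) (auto intro: continuous_intros)
  have "compact (K m)" for m
    unfolding K_def by (rule compact_Pi_UNIV) simp
  moreover have "closed (D m)" for m
    unfolding D_def s_def
    by (intro closed_Collect_conj closed_Collect_all closed_Collect_imp closed_Collect_eq closed_Collect_le
        open_Collect_const continuous_intros coord)
  ultimately have KD: "compact (K m \<inter> D m)" for m by (rule compact_Int_closed)
  have "closed C"
    unfolding C_def norm21_def by (intro closed_Collect_le continuous_intros coord1 coord2)
  then have cl: "closed {X. \<exists>H\<in>K m \<inter> D m. (H, X) \<in> C}" for m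
    by (rule closed_projection_along_compact[OF KD])
  have "{X. \<not> unique_l21_solution A n N L (\<lambda>j l. X (j, l))} = (\<Union>m. {X. \<exists>H\<in>K m \<inter> D m. (H, X) \<in> C})"
  proof (intro equalityI subsetI)
    fix X assume "X \<in> {X. \<not> unique_l21_solution A n N L (\<lambda>j l. X (j, l))}"
    then obtain H where H: "\<forall>i<n. \<forall>l<L. mat_mult A N H i l = 0" "\<exists>j<N. \<exists>l<L. H j l \<noteq> 0"
      "norm21 N L (\<lambda>j l. X (j, l) + H j l) \<le> norm21 N L (\<lambda>j l. X (j, l))"
      by (auto simp: not_unique_l21_solution_iff)
    \<comment> \<open>Truncation to the block puts the direction into some \<open>K m\<close>
      without changing the kernel condition or the norms.\<close>
    define G where "G = (\<lambda>(j, l). if j < N \<and> l < L then H j l else 0)"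
    have GH: "G (j, l) = H j l" if "j < N" "l < L" for j l using that by (simp add: G_def)
    have s0: "s G > 0"
    proof -
      obtain j l where "j < N" "l < L" "H j l \<noteq> 0" using H(2) by blast
      then have "0 < cmod (G (j, l))" by (simp add: GH)
      also have "\<dots> \<le> (\<Sum>l<L. cmod (G (j, l)))" using \<open>l < L\<close> by (intro member_le_sum) auto
      also have "\<dots> \<le> s G" unfolding s_def using \<open>j < N\<close>
        by (intro member_le_sum[where f = "\<lambda>j. \<Sum>l<L. cmod (G (j, l))"]) (auto intro: sum_nonneg)
      finally show ?thesis .
    qed
    have le_s: "cmod (G p) \<le> (if p \<in> {..<N} \<times> {..<L} then s G else 0)" for p
    proof (cases "p \<in> {..<N} \<times> {..<L}")
      case True
      then obtain j l where p: "p = (j, l)" "j < N" "l < L" by auto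
      have "cmod (G p) \<le> (\<Sum>l<L. cmod (G (j, l)))" unfolding p(1)
        using p by (intro member_le_sum[where f = "\<lambda>l. cmod (G (j, l))"]) auto
      also have "\<dots> \<le> s G" unfolding s_def using p
        by (intro member_le_sum[where f = "\<lambda>j. \<Sum>l<L. cmod (G (j, l))"]) (auto intro: sum_nonneg)
      finally show ?thesis using True by simp
    next
      case False
      then show ?thesis by (auto simp: G_def split: prod.splits)
    qed
    obtain m where m: "s G \<le> real m" "1 / Suc m \<le> s G"
    proof -
      obtain m1 where m1: "s G \<le> real m1" using real_arch_simple by blast
      obtain m2 where m2: "1 / Suc m2 < s G" using s0 nat_approx_posE by blast
      have "1 / Suc (max m1 m2) \<le> 1 / Suc m2" by (intro divide_left_mono) auto
      then show ?thesis using m1 m2 by (intro that[of "max m1 m2"]) auto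
    qed
    have "G \<in> K m" unfolding K_def mem_Collect_eq
    proof (intro allI)
      fix p
      show "G p \<in> cball 0 (if p \<in> {..<N} \<times> {..<L} then real m else 0)"
        using le_s[of p] m(1) by (simp split: if_splits)
    qed
    moreover have "G \<in> D m" using m H(1) by (simp add: D_def mat_mult_def GH)
    moreover have "norm21 N L (\<lambda>j l. X (j, l) + G (j, l)) = norm21 N L (\<lambda>j l. X (j, l) + H j l)"
      by (intro norm21_cong) (simp add: GH)
    then have "(G, X) \<in> C" using H(3) by (simp add: C_def)
    ultimately show "X \<in> (\<Union>m. {X. \<exists>H\<in>K m \<inter> D m. (H, X) \<in> C})" by blast
  next
    fix X assume "X \<in> (\<Union>m. {X. \<exists>H\<in>K m \<inter> D m. (H, X) \<in> C})"
    then obtain m H where H: "H \<in> D m" "(H, X) \<in> C" by auto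
    have "\<exists>j<N. \<exists>l<L. H (j, l) \<noteq> 0"
    proof (rule ccontr)
      assume "\<not> ?thesis"
      then have "s H = 0" by (simp add: s_def)
      then show False using H(1) by (simp add: D_def)
    qed
    then show "X \<in> {X. \<not> unique_l21_solution A n N L (\<lambda>j l. X (j, l))}"
      using H unfolding mem_Collect_eq not_unique_l21_solution_iff
      by (intro exI[of _ "\<lambda>j l. H (j, l)"]) (simp add: C_def D_def mat_mult_def)
  qed
  then show ?thesis using cl by (auto intro: borel_closed)
qed

lemma unique_l21_solution_event:
  "{\<Phi> \<in> space (gauss_entries S L). unique_l21_solution A n N L (X_of S \<sigma> \<Phi>)} \<in> sets (gauss_entries S L)"
proof -
  \<comment> \<open>Columns from \<open>L\<close> on are not coordinates of the product measure;
    \<open>g\<close> sets them to 0, which optimality does not see.\<close>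
  define g where "g = (\<lambda>\<Phi> :: nat \<times> nat \<Rightarrow> real. \<lambda>p. if p \<in> S \<times> {..<L} then complex_of_real (\<sigma> (fst p) * \<Phi> p) else 0)"
  have [measurable]: "g \<in> borel_measurable (gauss_entries S L)"
  proof (rule measurable_coordinatewise_then_product)
    fix p
    show "(\<lambda>\<Phi>. g \<Phi> p) \<in> borel_measurable (gauss_entries S L)"
      unfolding g_def gauss_entries_def
      by (cases "p \<in> S \<times> {..<L}") auto
  qed
  have "norm21 N L (\<lambda>j l. g \<Phi> (j, l) + H j l) = norm21 N L (\<lambda>j l. X_of S \<sigma> \<Phi> j l + H j l)" for \<Phi> H
    by (intro norm21_cong) (auto simp: g_def X_of_def)
  moreover have "norm21 N L (\<lambda>j l. g \<Phi> (j, l)) = norm21 N L (X_of S \<sigma> \<Phi>)" for \<Phi>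
    by (intro norm21_cong) (auto simp: g_def X_of_def)
  ultimately have "\<not> unique_l21_solution A n N L (X_of S \<sigma> \<Phi>) \<longleftrightarrow> \<not> unique_l21_solution A n N L (\<lambda>j l. g \<Phi> (j, l))" for \<Phi>
    unfolding not_unique_l21_solution_iff by simp
  then have eq: "unique_l21_solution A n N L (X_of S \<sigma> \<Phi>) \<longleftrightarrow> unique_l21_solution A n N L (\<lambda>j l. g \<Phi> (j, l))" for \<Phi>
    by blast
  have "g -` {X. \<not> unique_l21_solution A n N L (\<lambda>j l. X (j, l))} \<inter> space (gauss_entries S L) \<in> sets (gauss_entries S L)"
    by (rule measurable_sets[OF _ borel_non_unique]) measurable
  then have "space (gauss_entries S L) - (g -` {X. \<not> unique_l21_solution A n N L (\<lambda>j l. X (j, l))} \<inter> space (gauss_entries S L)) \<in> sets (gauss_entries S L)"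
    by (rule sets.compl_sets)
  also have "space (gauss_entries S L) - (g -` {X. \<not> unique_l21_solution A n N L (\<lambda>j l. X (j, l))} \<inter> space (gauss_entries S L))
     = {\<Phi> \<in> space (gauss_entries S L). unique_l21_solution A n N L (X_of S \<sigma> \<Phi>)}"
    by (auto simp: eq)
  finally show ?thesis .
qed

section \<open>Operator norms via integer points\<close>

text \<open>Integer points of l1 norm at most \<open>3 * L / 2\<close>, the range reached by
  rounding points of the sphere of radius \<open>sqrt L\<close>. The box is wide enough for all of
  them; with extensionality it makes finiteness immediate and lets sums factor over
  coordinates.\<close>

definition lattice_net :: "nat \<Rightarrow> (nat \<Rightarrow> int) set" where
  "lattice_net L = {z \<in> PiE {..<L} (\<lambda>_. {- int (2 * L)..int (2 * L)}). 2 * (\<Sum>l<L. nat \<bar>z l\<bar>) \<le> 3 * L}"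

lemma finite_lattice_net: "finite (lattice_net L)"
  unfolding lattice_net_def by (rule finite_subset[of _ "PiE {..<L} (\<lambda>_. {- int (2 * L)..int (2 * L)})"]) (auto intro: finite_PiE)

text \<open>The two-sided geometric series has sum
  \<open>1 + 2 * (4 / 9) / (1 - 4 / 9) = 13 / 5\<close>; the induction tracks the exact partial
  sum.\<close>

lemma sum_power_abs_le:
  "(\<Sum>z\<in>{- int B..int B}. (4 / 9 :: real) ^ nat \<bar>z\<bar>) \<le> 13 / 5"
proof -
  have "(\<Sum>z\<in>{- int B..int B}. (4 / 9 :: real) ^ nat \<bar>z\<bar>) = 13 / 5 - 8 / 5 * (4 / 9) ^ B"
  proof (induction B)
    case (Suc B)
    have "{- int (Suc B)..int (Suc B)} = insert (int (Suc B)) (insert (- int (Suc B)) {- int B..int B})"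
      by auto
    then show ?case using Suc by (simp add: nat_add_distrib)
  qed simp
  also have "\<dots> \<le> 13 / 5" by simp
  finally show ?thesis .
qed

text \<open>Weighting z by \<open>(4/9)\<close> to the power \<open>\<Sum>\<bar>z\<^sub>l\<bar>\<close> gives \<open>(27/8 \<sqdot> 13/5)\<^sup>L\<close>.\<close>
lemma card_lattice_net_le: "real (card (lattice_net L)) \<le> 9 ^ L"
proof -
  let ?P = "PiE {..<L} (\<lambda>_. {- int (2 * L)..int (2 * L)})"
  \<comment> \<open>Base \<open>2 / 3\<close> with doubled exponents stands for base
    \<open>4 / 9\<close>, which avoids the half-integer exponent \<open>3 * L / 2\<close>.\<close>
  have "real (card (lattice_net L)) * (2 / 3) ^ (3 * L) = (\<Sum>z\<in>lattice_net L. (2 / 3 :: real) ^ (3 * L))" by simp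
  also have "\<dots> \<le> (\<Sum>z\<in>lattice_net L. (2 / 3 :: real) ^ (2 * (\<Sum>l<L. nat \<bar>z l\<bar>)))"
    by (intro sum_mono power_decreasing) (auto simp: lattice_net_def)
  also have "\<dots> \<le> (\<Sum>z\<in>?P. (2 / 3 :: real) ^ (2 * (\<Sum>l<L. nat \<bar>z l\<bar>)))"
    by (intro sum_mono2 finite_PiE) (auto simp: lattice_net_def)
  also have "\<dots> = (\<Sum>z\<in>?P. \<Prod>l<L. (4 / 9 :: real) ^ nat \<bar>z l\<bar>)"
    by (simp add: power_mult power_sum power2_eq_square power_divide)
  also have "\<dots> = (\<Prod>l<L. \<Sum>z\<in>{- int (2 * L)..int (2 * L)}. (4 / 9 :: real) ^ nat \<bar>z\<bar>)"
    by (subst prod_sum_PiE) auto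
  also have "\<dots> \<le> (\<Prod>l<L. 13 / 5)"
    by (intro prod_mono conjI sum_nonneg sum_power_abs_le) auto
  \<comment> \<open>\<open>13 / 5\<close> is rounded up to \<open>8 / 3\<close> because division by
    \<open>(2 / 3) ^ 3 = 8 / 27\<close> then gives exactly 9.\<close>
  also have "\<dots> \<le> (8 / 3) ^ L" by (simp add: power_mono)
  finally have "real (card (lattice_net L)) * (8 / 27) ^ L \<le> (8 / 3) ^ L"
    by (simp add: power_mult power3_eq_cube)
  moreover have "(8 / 3 :: real) ^ L = 9 ^ L * (8 / 27) ^ L" by (simp add: power_mult_distrib[symmetric])
  ultimately show ?thesis by simp
qed

text \<open>Round \<open>sqrt L * y\<close> coordinatewise. Its l1 norm is at most \<open>L\<close>
  by Cauchy-Schwarz and grows by at most \<open>L / 2\<close>, so the result lies in the net. The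
  squared distance is at most \<open>L / 4\<close>; expanding it bounds the inner product below by
  \<open>3 / 4 * L\<close> plus the squared length of \<open>z\<close>, up to the factor
  \<open>2 * sqrt L\<close>, and the arithmetic-geometric mean inequality gives squared cosine at
  least 3/4.\<close>

lemma lattice_net_approximates:
  assumes y: "(\<Sum>l<L. (y l)\<^sup>2) = 1"
  shows "\<exists>z\<in>lattice_net L. 0 < (\<Sum>l<L. (real_of_int (z l))\<^sup>2) \<and>
     3 / 4 * (\<Sum>l<L. (real_of_int (z l))\<^sup>2) \<le> (\<Sum>l<L. y l * real_of_int (z l))\<^sup>2"
proof -
  define z where "z = (\<lambda>l\<in>{..<L}. round (sqrt L * y l))"
  have "L > 0" using y by (cases L) auto
  have err: "\<bar>sqrt L * y l - z l\<bar> \<le> 1 / 2" if "l < L" for l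
    using of_int_round_abs_le[of "sqrt L * y l"] that by (simp add: z_def abs_minus_commute)
  let ?zz = "\<Sum>l<L. (real_of_int (z l))\<^sup>2" and ?yz = "\<Sum>l<L. y l * real_of_int (z l)"
  have "(\<Sum>l<L. real (nat \<bar>z l\<bar>)) \<le> (\<Sum>l<L. sqrt L * \<bar>y l\<bar> + 1 / 2)"
  proof (intro sum_mono)
    fix l assume "l \<in> {..<L}"
    then have "\<bar>sqrt L * y l - z l\<bar> \<le> 1 / 2" using err by simp
    then have "\<bar>real_of_int (z l)\<bar> \<le> \<bar>sqrt L * y l\<bar> + 1 / 2" by linarith
    then show "real (nat \<bar>z l\<bar>) \<le> sqrt L * \<bar>y l\<bar> + 1 / 2" by (simp add: abs_mult)
  qed
  also have "\<dots> = sqrt L * (\<Sum>l<L. \<bar>y l\<bar>) + L / 2" by (simp add: sum.distrib sum_distrib_left)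
  also have "(\<Sum>l<L. \<bar>y l\<bar>) \<le> sqrt L"
    using L2_set_mult_ineq[of "\<lambda>_. 1" y "{..<L}"] y by (simp add: L2_set_def)
  finally have "2 * (\<Sum>l<L. real (nat \<bar>z l\<bar>)) \<le> 3 * real L" by (simp add: mult_left_mono)
  then have zsum: "2 * (\<Sum>l<L. nat \<bar>z l\<bar>) \<le> 3 * L"
    unfolding of_nat_sum[symmetric] by linarith
  have "z l \<in> {- int (2 * L)..int (2 * L)}" if "l < L" for l
  proof -
    have "nat \<bar>z l\<bar> \<le> (\<Sum>l<L. nat \<bar>z l\<bar>)"
      using that by (intro member_le_sum[where f = "\<lambda>l. nat \<bar>z l\<bar>"]) auto
    then have "nat \<bar>z l\<bar> \<le> 2 * L" using zsum by linarith
    then show ?thesis by auto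
  qed
  then have net: "z \<in> lattice_net L" using zsum unfolding lattice_net_def
    by (auto simp: z_def PiE_def extensional_def)
  have "(\<Sum>l<L. (sqrt L * y l - z l)\<^sup>2) \<le> (\<Sum>l<L. (1 / 2)\<^sup>2)"
    using err by (intro sum_mono) (metis abs_le_square_iff abs_of_pos half_gt_zero zero_less_one lessThan_iff)
  moreover have "(\<Sum>l<L. (sqrt L * y l - z l)\<^sup>2) = L * (\<Sum>l<L. (y l)\<^sup>2) + ?zz - 2 * sqrt L * ?yz"
    by (simp add: power2_diff power_mult_distrib sum.distrib sum_subtractf sum_distrib_left mult_ac)
  ultimately have 1: "3 / 4 * L + ?zz \<le> 2 * sqrt L * ?yz" using y by (simp add: power2_eq_square)
  have zz0: "?zz \<ge> 0" by (simp add: sum_nonneg)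
  have "(3 / 4 * L + ?zz)\<^sup>2 \<le> (2 * sqrt L * ?yz)\<^sup>2" using 1 zz0 by (intro power_mono) auto
  moreover have "3 * L * ?zz \<le> (3 / 4 * L + ?zz)\<^sup>2"
    using zero_le_power2[of "3 / 4 * L - ?zz"] by (simp add: power2_eq_square algebra_simps)
  ultimately have "real L * (3 * ?zz) \<le> real L * (4 * ?yz\<^sup>2)" by (simp add: power_mult_distrib algebra_simps)
  then have "3 / 4 * ?zz \<le> ?yz\<^sup>2" using \<open>L > 0\<close> by simp
  moreover have "?zz > 0"
  proof (rule ccontr)
    assume "\<not> ?zz > 0"
    then have "?zz = 0" using zz0 by simp
    then have "\<forall>l<L. z l = 0" by (subst (asm) sum_nonneg_eq_0_iff) auto
    then have "?yz = 0" by simp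
    then show False using 1 \<open>?zz = 0\<close> \<open>L > 0\<close> by simp
  qed
  ultimately show ?thesis using net by blast
qed

text \<open>First-order optimality: for small \<open>t\<close> of the sign of \<open>a\<close> the
  linear term would win, and \<open>a / (\<bar>c\<bar> + 1)\<close> is small enough for every
  \<open>c\<close>.\<close>

lemma linear_le_quadratic_imp_zero:
  fixes a c :: real
  assumes "\<And>t. 2 * t * a \<le> t\<^sup>2 * c"
  shows "a = 0"
proof (rule ccontr)
  assume "a \<noteq> 0"
  define t where "t = a / (\<bar>c\<bar> + 1)"
  have "2 * t * a = (a\<^sup>2 / (\<bar>c\<bar> + 1)) * 2" by (simp add: t_def power2_eq_square)
  moreover have "t\<^sup>2 * c = (a\<^sup>2 / (\<bar>c\<bar> + 1)) * (c / (\<bar>c\<bar> + 1))" by (simp add: t_def power2_eq_square)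
  moreover have "(a\<^sup>2 / (\<bar>c\<bar> + 1)) * (c / (\<bar>c\<bar> + 1)) < (a\<^sup>2 / (\<bar>c\<bar> + 1)) * 2"
  proof (rule mult_strict_left_mono)
    show "a\<^sup>2 / (\<bar>c\<bar> + 1) > 0" using \<open>a \<noteq> 0\<close> by (intro divide_pos_pos) auto
    show "c / (\<bar>c\<bar> + 1) < 2" by (subst pos_divide_less_eq) (linarith | simp)+
  qed
  ultimately show False using assms[of t] by linarith
qed

text \<open>\<open>y\<close> maximises the quadratic form on the unit sphere and \<open>s\<close> is
  the maximum, the squared operator norm. The identity for all \<open>x\<close> is the eigenvector
  equation \<open>U^T U y = s y\<close> in weak form.\<close>

lemma top_singular_vector_exists:
  fixes U :: "nat \<Rightarrow> nat \<Rightarrow> real"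
  assumes "L > 0"
  shows "\<exists>y s. (\<Sum>l<L. (y l)\<^sup>2) = 1 \<and> 0 \<le> s \<and>
    (\<forall>x. (\<Sum>j\<in>S. (\<Sum>l<L. U j l * x l)\<^sup>2) \<le> s * (\<Sum>l<L. (x l)\<^sup>2)) \<and>
    (\<forall>x. s * (\<Sum>l<L. y l * x l) = (\<Sum>j\<in>S. (\<Sum>l<L. U j l * y l) * (\<Sum>l<L. U j l * x l))) \<and>
    s = (\<Sum>j\<in>S. (\<Sum>l<L. U j l * y l)\<^sup>2)"
proof -
  define Q where "Q = (\<lambda>x. \<Sum>j\<in>S. (\<Sum>l<L. U j l * x l)\<^sup>2)"
  \<comment> \<open>The box and the zeros from index \<open>L\<close> on make the sphere compact in
    the infinite product.\<close>
  define K where "K = {x :: nat \<Rightarrow> real. \<forall>l. x l \<in> (if l < L then {-1..1} else {0})} \<inter> {x. (\<Sum>l<L. (x l)\<^sup>2) = 1}"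
  have "compact K"
    unfolding K_def
    by (intro compact_Int_closed compact_Pi_UNIV closed_Collect_eq continuous_intros continuous_on_product_coordinates) auto
  moreover have "(\<lambda>l. if l = 0 then 1 else 0) \<in> K"
    using assms by (auto simp: K_def power2_eq_square if_distrib[of "\<lambda>x. _ * x"] sum.delta cong: if_cong)
  then have "K \<noteq> {}" by blast
  moreover have "continuous_on K Q"
    unfolding Q_def by (intro continuous_intros continuous_on_subset[OF continuous_on_product_coordinates]) auto
  ultimately obtain y where y: "y \<in> K" and max: "\<And>x. x \<in> K \<Longrightarrow> Q x \<le> Q y"
    using continuous_attains_sup[of K Q] by blast
  have Q0: "Q x \<ge> 0" for x by (simp add: Q_def sum_nonneg)
  have bound: "Q x \<le> Q y * (\<Sum>l<L. (x l)\<^sup>2)" for x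
  proof (cases "(\<Sum>l<L. (x l)\<^sup>2) = 0")
    case True
    then have "\<forall>l<L. x l = 0" by (subst (asm) sum_nonneg_eq_0_iff) auto
    then show ?thesis by (simp add: Q_def)
  next
    case False
    define r where "r = sqrt (\<Sum>l<L. (x l)\<^sup>2)"
    have r2: "r\<^sup>2 = (\<Sum>l<L. (x l)\<^sup>2)" by (simp add: r_def sum_nonneg)
    have "r > 0" using False by (simp add: r_def less_le sum_nonneg)
    define x' where "x' = (\<lambda>l. if l < L then x l / r else 0)"
    have "- r \<le> x l \<and> x l \<le> r" if "l < L" for l
    proof -
      have "(x l)\<^sup>2 \<le> (\<Sum>l<L. (x l)\<^sup>2)" using that by (intro member_le_sum[where f = "\<lambda>l. (x l)\<^sup>2"]) auto
      then have "\<bar>x l\<bar> \<le> r" using r2 \<open>r > 0\<close> by (metis abs_le_square_iff abs_of_pos)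
      then show ?thesis by linarith
    qed
    moreover have "(\<Sum>l<L. (x' l)\<^sup>2) = 1"
      using r2 \<open>r > 0\<close> False by (simp add: x'_def power_divide sum_divide_distrib[symmetric])
    ultimately have "x' \<in> K" using \<open>r > 0\<close> by (auto simp: K_def x'_def field_simps)
    from max[OF this] have "Q x' \<le> Q y" .
    moreover have "Q x' = Q x / r\<^sup>2"
    proof -
      have "(\<Sum>l<L. U j l * x' l) = (\<Sum>l<L. U j l * x l) / r" for j
        by (simp add: x'_def sum_divide_distrib)
      then show ?thesis by (simp only: Q_def power_divide sum_divide_distrib[symmetric])
    qed
    ultimately show ?thesis using \<open>r > 0\<close> unfolding r2[symmetric] by (simp add: field_simps)
  qed
  have y1: "(\<Sum>l<L. (y l)\<^sup>2) = 1" using y by (simp add: K_def)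
  have stat: "Q y * (\<Sum>l<L. y l * x l) = (\<Sum>j\<in>S. (\<Sum>l<L. U j l * y l) * (\<Sum>l<L. U j l * x l))" for x
  proof -
    define b where "b = (\<Sum>j\<in>S. (\<Sum>l<L. U j l * y l) * (\<Sum>l<L. U j l * x l))"
    define c where "c = (\<Sum>l<L. y l * x l)"
    \<comment> \<open>\<open>bound\<close> is applied to the perturbed maximiser
      \<open>y + t x\<close>; the terms of order zero in \<open>t\<close> cancel.\<close>
    have "2 * t * (b - Q y * c) \<le> t\<^sup>2 * (Q y * (\<Sum>l<L. (x l)\<^sup>2) - Q x)" for t
    proof -
      have "Q (\<lambda>l. y l + t * x l) = Q y + 2 * t * b + t\<^sup>2 * Q x"
      proof -
        have "(\<Sum>l<L. U j l * (y l + t * x l)) = (\<Sum>l<L. U j l * y l) + t * (\<Sum>l<L. U j l * x l)" for j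
          by (simp add: distrib_left sum.distrib sum_distrib_left mult_ac)
        moreover define u v where "u = (\<lambda>j. \<Sum>l<L. U j l * y l)" and "v = (\<lambda>j. \<Sum>l<L. U j l * x l)"
        ultimately show ?thesis
          unfolding Q_def b_def u_def[symmetric, THEN fun_cong, simplified] v_def[symmetric, THEN fun_cong, simplified]
          by (simp add: power2_sum power_mult_distrib sum.distrib sum_distrib_left mult_ac)
      qed
      moreover have "(\<Sum>l<L. (y l + t * x l)\<^sup>2) = 1 + 2 * t * c + t\<^sup>2 * (\<Sum>l<L. (x l)\<^sup>2)"
        using y1 by (simp add: c_def power2_sum power_mult_distrib sum.distrib sum_distrib_left mult_ac)
      ultimately show ?thesis using bound[of "\<lambda>l. y l + t * x l"] by (simp add: algebra_simps)
    qed
    then have "b - Q y * c = 0" by (rule linear_le_quadratic_imp_zero)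
    then show ?thesis by (simp add: b_def c_def)
  qed
  show ?thesis
    by (rule exI[of _ y], rule exI[of _ "Q y"])
      (use y1 stat bound Q0 in \<open>auto simp: Q_def\<close>)
qed

text \<open>Testing the eigenvector equation on a net point \<open>z\<close> gives
  \<open>s <y, z> = <U y, U z>\<close>, and Cauchy-Schwarz with \<open>|U y|^2 = s\<close> yields
  \<open>s <y, z>^2 \<le> |U z|^2\<close>. Squared cosine 3/4 thus costs only the factor 3/4, so a
  net of wide angle is enough.\<close>

lemma operator_norm_le_of_net:
  fixes U :: "nat \<Rightarrow> nat \<Rightarrow> real"
  assumes "L > 0" "\<beta> \<ge> 0"
    and net: "\<And>z. z \<in> lattice_net L \<Longrightarrow> 0 < (\<Sum>l<L. (real_of_int (z l))\<^sup>2) \<Longrightarrow>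
      (\<Sum>j\<in>S. (\<Sum>l<L. U j l * real_of_int (z l))\<^sup>2) \<le> 3 / 4 * \<beta> * (\<Sum>l<L. (real_of_int (z l))\<^sup>2)"
  shows "(\<Sum>j\<in>S. (\<Sum>l<L. U j l * x l)\<^sup>2) \<le> \<beta> * (\<Sum>l<L. (x l)\<^sup>2)"
proof -
  obtain y s where y: "(\<Sum>l<L. (y l)\<^sup>2) = 1" and s: "0 \<le> s"
    and bound: "\<And>x. (\<Sum>j\<in>S. (\<Sum>l<L. U j l * x l)\<^sup>2) \<le> s * (\<Sum>l<L. (x l)\<^sup>2)"
    and stat: "\<And>x. s * (\<Sum>l<L. y l * x l) = (\<Sum>j\<in>S. (\<Sum>l<L. U j l * y l) * (\<Sum>l<L. U j l * x l))"
    and s_eq: "s = (\<Sum>j\<in>S. (\<Sum>l<L. U j l * y l)\<^sup>2)"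
    using top_singular_vector_exists[OF \<open>L > 0\<close>] by blast
  obtain z where z: "z \<in> lattice_net L" and zpos: "0 < (\<Sum>l<L. (real_of_int (z l))\<^sup>2)"
    and cosz: "3 / 4 * (\<Sum>l<L. (real_of_int (z l))\<^sup>2) \<le> (\<Sum>l<L. y l * real_of_int (z l))\<^sup>2"
    using lattice_net_approximates[OF y] by blast
  let ?zz = "\<Sum>l<L. (real_of_int (z l))\<^sup>2" and ?yz = "\<Sum>l<L. y l * real_of_int (z l)"
  have "s \<le> \<beta>"
  proof (cases "s = 0")
    case False
    have "(s * ?yz)\<^sup>2 \<le> s * (\<Sum>j\<in>S. (\<Sum>l<L. U j l * real_of_int (z l))\<^sup>2)"
      unfolding stat by (subst s_eq) (rule Cauchy_Schwarz_ineq_sum)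
    also have "\<dots> \<le> s * (3 / 4 * \<beta> * ?zz)"
      using net[OF z zpos] s by (rule mult_left_mono)
    finally have "s * (s * ?yz\<^sup>2) \<le> s * (3 / 4 * \<beta> * ?zz)" by (simp add: power2_eq_square mult_ac)
    then have "s * ?yz\<^sup>2 \<le> 3 / 4 * \<beta> * ?zz" using s False by simp
    moreover have "s * (3 / 4 * ?zz) \<le> s * ?yz\<^sup>2" using cosz s by (rule mult_left_mono)
    ultimately have "s * ?zz \<le> \<beta> * ?zz" by simp
    then show ?thesis using zpos by simp
  qed (use \<open>\<beta> \<ge> 0\<close> in simp)
  then have "s * (\<Sum>l<L. (x l)\<^sup>2) \<le> \<beta> * (\<Sum>l<L. (x l)\<^sup>2)"
    by (intro mult_right_mono) (auto intro: sum_nonneg)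
  then show ?thesis using bound[of x] by linarith
qed

text \<open>The net lives in dimension \<open>L\<close>, while the certificate needs the transpose
  acting on vectors indexed by \<open>S\<close>. For \<open>v = U^T x\<close> the bound transfers by
  Cauchy-Schwarz in \<open>|v|^2 = <x, U v>\<close>.\<close>

lemma transpose_operator_norm_le:
  fixes U :: "nat \<Rightarrow> nat \<Rightarrow> real"
  assumes "\<beta> \<ge> 0"
    and U: "\<And>x. (\<Sum>j\<in>S. (\<Sum>l<L. U j l * x l)\<^sup>2) \<le> \<beta> * (\<Sum>l<L. (x l)\<^sup>2)"
  shows "(\<Sum>l<L. (\<Sum>j\<in>S. U j l * x j)\<^sup>2) \<le> \<beta> * (\<Sum>j\<in>S. (x j)\<^sup>2)"
proof -
  define v where "v = (\<lambda>l. \<Sum>j\<in>S. U j l * x j)"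
  let ?vv = "\<Sum>l<L. (v l)\<^sup>2" and ?xx = "\<Sum>j\<in>S. (x j)\<^sup>2"
  have vv0: "?vv \<ge> 0" and xx0: "?xx \<ge> 0" by (auto intro: sum_nonneg)
  have "?vv = (\<Sum>l<L. \<Sum>j\<in>S. x j * (U j l * v l))"
    by (simp add: power2_eq_square, subst (1) v_def, simp add: sum_distrib_right sum_distrib_left mult_ac)
  also have "\<dots> = (\<Sum>j\<in>S. x j * (\<Sum>l<L. U j l * v l))"
    by (subst sum.swap) (simp add: sum_distrib_left)
  finally have "?vv\<^sup>2 = (\<Sum>j\<in>S. x j * (\<Sum>l<L. U j l * v l))\<^sup>2" by simp
  also have "\<dots> \<le> ?xx * (\<Sum>j\<in>S. (\<Sum>l<L. U j l * v l)\<^sup>2)" by (rule Cauchy_Schwarz_ineq_sum)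
  also have "\<dots> \<le> ?xx * (\<beta> * ?vv)" by (intro mult_left_mono U xx0)
  finally have *: "?vv * ?vv \<le> (\<beta> * ?xx) * ?vv" by (simp add: power2_eq_square mult_ac)
  have "?vv \<le> \<beta> * ?xx"
  proof (cases "?vv = 0")
    case False
    then show ?thesis using * vv0 by (simp add: mult_le_cancel_right)
  qed (use \<open>\<beta> \<ge> 0\<close> xx0 in simp)
  then show ?thesis by (simp add: v_def)
qed

section \<open>The random sign matrix\<close>

text \<open>Independence of the rows: one row block at a time is split off and integrated by
  Fubini.\<close>

lemma nn_integral_PiM_rows:
  fixes f :: "'j \<Rightarrow> ('i \<Rightarrow> real) \<Rightarrow> ennreal"
  assumes "finite S" "finite T" and [measurable]: "\<And>j. f j \<in> borel_measurable (PiM T (\<lambda>_. borel))"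
  shows "(\<integral>\<^sup>+x. (\<Prod>j\<in>S. f j (\<lambda>l\<in>T. x (j, l))) \<partial>PiM (S \<times> T) (\<lambda>_. gauss))
       = (\<Prod>j\<in>S. \<integral>\<^sup>+x. f j x \<partial>PiM T (\<lambda>_. gauss))"
  using assms(1)
proof (induction S rule: finite_induct)
  case empty
  interpret prob_space "PiM {} (\<lambda>_::'j \<times> 'i. gauss)" by (intro prob_space_PiM prob_space_gauss)
  show ?case by (simp add: emeasure_space_1)
next
  case (insert j S)
  interpret product_sigma_finite "\<lambda>_::'j \<times> 'i. gauss" by (rule product_sigma_finite_gauss)
  let ?J = "PiM ({j} \<times> T) (\<lambda>_. gauss)" and ?S = "PiM (S \<times> T) (\<lambda>_. gauss)"
  have split: "insert j S \<times> T = ({j} \<times> T) \<union> (S \<times> T)" by auto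
  have meas: "(\<lambda>x. f i (\<lambda>l\<in>T. x (i, l))) \<in> borel_measurable (PiM (R \<times> T) (\<lambda>_. gauss))" if "i \<in> R" for i R
  proof -
    have "(\<lambda>x. \<lambda>l\<in>T. x (i, l)) \<in> PiM (R \<times> T) (\<lambda>_. gauss) \<rightarrow>\<^sub>M PiM T (\<lambda>_. borel)"
      using that by (intro measurable_restrict) measurable
    then show ?thesis by (rule measurable_compose) measurable
  qed
  have row: "(\<integral>\<^sup>+x. f j (\<lambda>l\<in>T. x (j, l)) \<partial>?J) = (\<integral>\<^sup>+x. f j x \<partial>PiM T (\<lambda>_. gauss))"
  proof -
    \<comment> \<open>Renaming the index \<open>(j, l)\<close> to \<open>l\<close> identifies the
      law of a single row.\<close>
    have "distr ?J (PiM T (\<lambda>_. gauss)) (\<lambda>x. \<lambda>l\<in>T. x (j, l)) = PiM T (\<lambda>_. gauss)"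
      by (rule distr_PiM_reindex[of "{j} \<times> T" "\<lambda>_. gauss" "\<lambda>l. (j, l)" T]) (auto intro: prob_space_gauss inj_onI)
    then have "(\<integral>\<^sup>+x. f j x \<partial>PiM T (\<lambda>_. gauss)) = (\<integral>\<^sup>+x. f j x \<partial>distr ?J (PiM T (\<lambda>_. gauss)) (\<lambda>x. \<lambda>l\<in>T. x (j, l)))"
      by simp
    also have "\<dots> = (\<integral>\<^sup>+x. f j (\<lambda>l\<in>T. x (j, l)) \<partial>?J)"
      by (subst nn_integral_distr) (auto intro!: measurable_restrict measurable_component_singleton)
    finally show ?thesis by simp
  qed
  have "(\<integral>\<^sup>+x. (\<Prod>i\<in>insert j S. f i (\<lambda>l\<in>T. x (i, l))) \<partial>PiM (insert j S \<times> T) (\<lambda>_. gauss))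
     = (\<integral>\<^sup>+x. \<integral>\<^sup>+y. (\<Prod>i\<in>insert j S. f i (\<lambda>l\<in>T. merge ({j} \<times> T) (S \<times> T) (x, y) (i, l))) \<partial>?S \<partial>?J)"
    unfolding split using insert.hyps assms(2)
    by (subst product_nn_integral_fold)
      (auto intro!: borel_measurable_prod_ennreal meas[of _ "insert j S", unfolded split])
  also have "\<dots> = (\<integral>\<^sup>+x. \<integral>\<^sup>+y. f j (\<lambda>l\<in>T. x (j, l)) * (\<Prod>i\<in>S. f i (\<lambda>l\<in>T. y (i, l))) \<partial>?S \<partial>?J)"
  proof (intro nn_integral_cong)
    fix x y :: "'j \<times> 'i \<Rightarrow> real"
    have "(\<lambda>l\<in>T. merge ({j} \<times> T) (S \<times> T) (x, y) (j, l)) = (\<lambda>l\<in>T. x (j, l))"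
      by (auto simp: merge_def fun_eq_iff)
    moreover have "(\<lambda>l\<in>T. merge ({j} \<times> T) (S \<times> T) (x, y) (i, l)) = (\<lambda>l\<in>T. y (i, l))" if "i \<in> S" for i
      using that insert.hyps by (auto simp: merge_def fun_eq_iff)
    ultimately show "(\<Prod>i\<in>insert j S. f i (\<lambda>l\<in>T. merge ({j} \<times> T) (S \<times> T) (x, y) (i, l)))
       = f j (\<lambda>l\<in>T. x (j, l)) * (\<Prod>i\<in>S. f i (\<lambda>l\<in>T. y (i, l)))"
      using insert.hyps by simp
  qed
  also have "\<dots> = (\<integral>\<^sup>+x. f j (\<lambda>l\<in>T. x (j, l)) \<partial>?J) * (\<integral>\<^sup>+y. (\<Prod>i\<in>S. f i (\<lambda>l\<in>T. y (i, l))) \<partial>?S)"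
    by (subst nn_integral_cmult, (auto intro!: borel_measurable_prod_ennreal meas)[1],
        subst nn_integral_multc) (auto intro!: meas)
  also have "\<dots> = (\<Prod>i\<in>insert j S. \<integral>\<^sup>+x. f i x \<partial>PiM T (\<lambda>_. gauss))"
    unfolding row insert.IH using insert.hyps by simp
  finally show ?case .
qed

text \<open>This is \<open>\<parallel>U z\<parallel>\<^sup>2\<close>; zero rows of \<open>\<Phi>\<close> contribute 0 because \<open>0 / 0 = 0\<close>.\<close>
definition normalized_form :: "nat set \<Rightarrow> nat \<Rightarrow> (nat \<Rightarrow> real) \<Rightarrow> (nat \<times> nat \<Rightarrow> real) \<Rightarrow> real" where
  "normalized_form S L z \<Phi> = (\<Sum>j\<in>S. (\<Sum>l<L. z l * \<Phi> (j, l))\<^sup>2 / (\<Sum>l<L. (\<Phi> (j, l))\<^sup>2))"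

section \<open>Chernoff and union bounds for the normalised form\<close>

lemma prob_space_gauss_entries: "prob_space (gauss_entries S L)"
  unfolding gauss_entries_def by (intro prob_space_PiM prob_space_gauss)

lemma measurable_normalized_form [measurable]:
  "normalized_form S L z \<in> borel_measurable (gauss_entries S L)"
proof -
  have [measurable]: "(\<lambda>\<Phi>. \<Phi> (j, l)) \<in> borel_measurable (gauss_entries S L)" if "j \<in> S" "l < L" for j l
    unfolding gauss_entries_def
    using measurable_component_singleton[of "(j, l)" "S \<times> {..<L}" "\<lambda>_. gauss"] that by simp
  show ?thesis unfolding normalized_form_def
    by (intro borel_measurable_sum borel_measurable_divide borel_measurable_power borel_measurable_times) auto
qed

lemma normalized_form_mgf:
  assumes "finite S" and z: "(\<Sum>l<L. (z l)\<^sup>2) = 1"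
  shows "(\<integral>\<^sup>+\<Phi>. ennreal (exp (3 / 8 * L * normalized_form S L z \<Phi>)) \<partial>gauss_entries S L) \<le> 2 ^ card S"
proof -
  define f :: "(nat \<Rightarrow> real) \<Rightarrow> ennreal" where
    "f = (\<lambda>x. ennreal (exp (3 / 8 * L * ((\<Sum>l<L. z l * x l)\<^sup>2 / (\<Sum>l<L. (x l)\<^sup>2)))))"
  have [measurable]: "f \<in> borel_measurable (PiM {..<L} (\<lambda>_. borel))" unfolding f_def by measurable
  have "(\<integral>\<^sup>+\<Phi>. ennreal (exp (3 / 8 * L * normalized_form S L z \<Phi>)) \<partial>gauss_entries S L)
     = (\<integral>\<^sup>+\<Phi>. (\<Prod>j\<in>S. f (\<lambda>l\<in>{..<L}. \<Phi> (j, l))) \<partial>PiM (S \<times> {..<L}) (\<lambda>_. gauss))"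
    unfolding gauss_entries_def
    by (intro nn_integral_cong)
      (simp add: f_def normalized_form_def sum_distrib_left exp_sum \<open>finite S\<close> prod_ennreal)
  also have "\<dots> = (\<Prod>j\<in>S. \<integral>\<^sup>+x. f x \<partial>PiM {..<L} (\<lambda>_. gauss))"
    using \<open>finite S\<close> by (rule nn_integral_PiM_rows) auto
  also have "\<dots> \<le> (\<Prod>j\<in>S. 2)"
    using PiM_gauss_normalized_mgf[of "{..<L}" z] z by (intro prod_mono_ennreal) (simp add: f_def)
  finally show ?thesis by simp
qed

text \<open>Chernoff bound with parameter \<open>3 / 8 * L\<close>. Multiplied by it, the threshold
  for the unit vector becomes \<open>c\<close>, whose part \<open>9 / 8 * card S\<close> absorbs the
  factor \<open>2 ^ card S\<close> of the moment bound. The \<open>3 / 4\<close> in \<open>t\<close>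
  is the loss in \<open>operator_norm_le_of_net\<close>.\<close>

lemma normalized_form_tail:
  assumes "finite S" "L > 0" and z: "(\<Sum>l<L. (z l)\<^sup>2) > 0"
  defines "t \<equiv> 3 / 4 * (9 + 4 * real (card S) / real L) * (\<Sum>l<L. (z l)\<^sup>2)"
  shows "measure (gauss_entries S L) {\<Phi> \<in> space (gauss_entries S L). t < normalized_form S L z \<Phi>}
     \<le> exp (- (81 / 32) * L)"
proof -
  interpret prob_space "gauss_entries S L" by (rule prob_space_gauss_entries)
  define r where "r = sqrt (\<Sum>l<L. (z l)\<^sup>2)"
  have r2: "r\<^sup>2 = (\<Sum>l<L. (z l)\<^sup>2)" and "r > 0" using z by (auto simp: r_def)
  define w where "w = (\<lambda>l. z l / r)"
  have w: "(\<Sum>l<L. (w l)\<^sup>2) = 1"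
    using z by (simp add: w_def power_divide sum_divide_distrib[symmetric] r2)
  have nf: "normalized_form S L w \<Phi> = normalized_form S L z \<Phi> / r\<^sup>2" for \<Phi>
  proof -
    have "(\<Sum>l<L. w l * \<Phi> (j, l)) = (\<Sum>l<L. z l * \<Phi> (j, l)) / r" for j
      by (simp add: w_def sum_divide_distrib)
    then show ?thesis
      unfolding normalized_form_def sum_divide_distrib[of _ S] by (simp only: power_divide divide_divide_eq_left mult.commute)
  qed
  define c where "c = 81 / 32 * real L + 9 / 8 * real (card S)"
  have "emeasure (gauss_entries S L) {\<Phi> \<in> space (gauss_entries S L). t < normalized_form S L z \<Phi>}
     \<le> emeasure (gauss_entries S L) {\<Phi> \<in> space (gauss_entries S L).
          1 \<le> ennreal (exp (- c)) * ennreal (exp (3 / 8 * L * normalized_form S L w \<Phi>))}"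
  proof (intro emeasure_mono subsetI)
    fix \<Phi> assume "\<Phi> \<in> {\<Phi> \<in> space (gauss_entries S L). t < normalized_form S L z \<Phi>}"
    then have sp: "\<Phi> \<in> space (gauss_entries S L)" and "t < normalized_form S L z \<Phi>" by auto
    then have "3 / 4 * (9 + 4 * real (card S) / real L) \<le> normalized_form S L w \<Phi>"
      using \<open>r > 0\<close> by (simp add: nf t_def r2[symmetric] pos_le_divide_eq)
    then have "3 / 8 * L * (3 / 4 * (9 + 4 * real (card S) / real L)) \<le> 3 / 8 * L * normalized_form S L w \<Phi>"
      by (intro mult_left_mono) auto
    moreover have "3 / 8 * L * (3 / 4 * (9 + 4 * real (card S) / real L)) = c"
      using \<open>L > 0\<close> by (simp add: c_def field_simps)
    ultimately have "1 \<le> exp (- c + 3 / 8 * L * normalized_form S L w \<Phi>)" by simp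
    then have "1 \<le> ennreal (exp (- c) * exp (3 / 8 * L * normalized_form S L w \<Phi>))"
      by (simp add: exp_add[symmetric] del: ennreal_1 add: ennreal_1[symmetric])
    then show "\<Phi> \<in> {\<Phi> \<in> space (gauss_entries S L).
          1 \<le> ennreal (exp (- c)) * ennreal (exp (3 / 8 * L * normalized_form S L w \<Phi>))}"
      using sp by (simp add: ennreal_mult)
  qed measurable
  also have "\<dots> \<le> ennreal (exp (- c)) * (\<integral>\<^sup>+\<Phi>. ennreal (exp (3 / 8 * L * normalized_form S L w \<Phi>)) \<partial>gauss_entries S L)"
    using nn_integral_Markov_inequality[of "\<lambda>\<Phi>. ennreal (exp (3 / 8 * L * normalized_form S L w \<Phi>))"
        "space (gauss_entries S L)" "gauss_entries S L" "ennreal (exp (- c))"]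
    by (simp cong: nn_integral_cong_simp)
  also have "\<dots> \<le> ennreal (exp (- c)) * 2 ^ card S"
    by (intro mult_left_mono normalized_form_mgf \<open>finite S\<close> w) auto
  also have "\<dots> = ennreal (exp (- c) * 2 ^ card S)"
    by (simp add: ennreal_mult ennreal_power[symmetric])
  finally have "measure (gauss_entries S L) {\<Phi> \<in> space (gauss_entries S L). t < normalized_form S L z \<Phi>}
     \<le> exp (- c) * 2 ^ card S"
    by (simp add: emeasure_eq_measure)
  also have "(2::real) ^ card S \<le> exp (9 / 8) ^ card S"
    using exp_ge_add_one_self[of "9 / 8 :: real"] by (intro power_mono) auto
  also have "exp (9 / 8 :: real) ^ card S = exp (9 / 8 * real (card S))"
    by (simp add: exp_of_nat_mult[symmetric] mult.commute)
  also have "exp (- c) * exp (9 / 8 * real (card S)) = exp (- (81 / 32) * L)"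
    by (simp add: c_def exp_add[symmetric])
  finally show ?thesis by simp
qed

text \<open>Balance of the union bound: per dimension, 9 directions against the decay rate
  \<open>81 / 32\<close> must leave \<open>1 / 8\<close>, that is
  \<open>9 \<le> exp (77 / 32)\<close>. The fourth power of the quadratic Taylor bound 1.78 for
  \<open>exp (3 / 5)\<close> suffices.\<close>

lemma nine_exp_le: "9 * exp (- (81 / 32)) \<le> exp (- (1 / 8) :: real)"
proof -
  have "(9::real) \<le> (178 / 100) ^ 4" by (simp add: power_divide)
  also have "\<dots> \<le> exp (3 / 5) ^ 4"
    using exp_lower_Taylor_quadratic[of "3 / 5 :: real"] by (intro power_mono) (auto simp: power2_eq_square)
  also have "\<dots> = exp (12 / 5)" by (simp add: exp_of_nat_mult[symmetric])
  also have "\<dots> \<le> exp (77 / 32)" by simp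
  finally have "9 * exp (- (81 / 32)) \<le> exp (77 / 32) * exp (- (81 / 32) :: real)" by (intro mult_right_mono) auto
  then show ?thesis by (simp add: exp_add[symmetric])
qed

lemma normalized_form_net_tail:
  assumes "finite S" "L > 0"
  shows "measure (gauss_entries S L) {\<Phi> \<in> space (gauss_entries S L). \<exists>z\<in>lattice_net L.
      0 < (\<Sum>l<L. (real_of_int (z l))\<^sup>2) \<and>
      3 / 4 * (9 + 4 * real (card S) / real L) * (\<Sum>l<L. (real_of_int (z l))\<^sup>2)
        < normalized_form S L (\<lambda>l. real_of_int (z l)) \<Phi>} \<le> exp (- real L / 8)"
proof -
  interpret prob_space "gauss_entries S L" by (rule prob_space_gauss_entries)
  define Z where "Z = {z \<in> lattice_net L. 0 < (\<Sum>l<L. (real_of_int (z l))\<^sup>2)}"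
  define B where "B = (\<lambda>z::nat \<Rightarrow> int. {\<Phi> \<in> space (gauss_entries S L).
      3 / 4 * (9 + 4 * real (card S) / real L) * (\<Sum>l<L. (real_of_int (z l))\<^sup>2)
        < normalized_form S L (\<lambda>l. real_of_int (z l)) \<Phi>})"
  have finZ: "finite Z" unfolding Z_def using finite_lattice_net by simp
  have eq: "{\<Phi> \<in> space (gauss_entries S L). \<exists>z\<in>lattice_net L.
      0 < (\<Sum>l<L. (real_of_int (z l))\<^sup>2) \<and>
      3 / 4 * (9 + 4 * real (card S) / real L) * (\<Sum>l<L. (real_of_int (z l))\<^sup>2)
        < normalized_form S L (\<lambda>l. real_of_int (z l)) \<Phi>} = (\<Union>z\<in>Z. B z)"
    by (auto simp: Z_def B_def)
  have "measure (gauss_entries S L) (\<Union>z\<in>Z. B z) \<le> (\<Sum>z\<in>Z. measure (gauss_entries S L) (B z))"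
    using finZ by (intro finite_measure_subadditive_finite) (auto simp: B_def)
  also have "\<dots> \<le> (\<Sum>z\<in>Z. exp (- (81 / 32) * L))"
    unfolding B_def by (intro sum_mono normalized_form_tail assms) (auto simp: Z_def)
  also have "\<dots> \<le> 9 ^ L * exp (- (81 / 32) * L)"
  proof -
    have "real (card Z) \<le> real (card (lattice_net L))"
      unfolding Z_def by (intro of_nat_mono card_mono finite_lattice_net) auto
    also have "\<dots> \<le> 9 ^ L" by (rule card_lattice_net_le)
    finally show ?thesis by (simp add: mult_right_mono)
  qed
  also have "\<dots> = (9 * exp (- (81 / 32))) ^ L"
    by (simp add: power_mult_distrib exp_of_nat_mult[symmetric] mult.commute)
  also have "\<dots> \<le> exp (- (1 / 8)) ^ L" by (intro power_mono nine_exp_le) auto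
  also have "\<dots> = exp (- real L / 8)" by (simp add: exp_of_nat_mult[symmetric])
  finally show ?thesis unfolding eq .
qed

section \<open>The constant \<open>A_L\<close> and the final assembly\<close>

lemma A_const_pos: "L > 0 \<Longrightarrow> A_const L > 0"
  by (simp add: A_const_def Gamma_real_pos)

text \<open>\<open>(L + 1) / 2\<close> is the midpoint of \<open>L / 2\<close> and
  \<open>L / 2 + 1\<close>, so log-convexity and the functional equation of Gamma bound the squared
  ratio by \<open>L / 2\<close>.\<close>

lemma A_const_le_sqrt:
  assumes "L > 0"
  shows "A_const L \<le> sqrt L"
proof -
  let ?x = "real L / 2"
  have x: "?x > 0" using assms by simp
  have pos: "0 < (Gamma ((real L + 1) / 2))\<^sup>2" "0 < Gamma ?x * Gamma (?x + 1)"
    using x by (intro zero_less_power mult_pos_pos Gamma_real_pos; simp)+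
  have "(ln \<circ> Gamma) ((1 - 1 / 2) *\<^sub>R ?x + (1 / 2) *\<^sub>R (?x + 1)) \<le> (1 - 1 / 2) * (ln \<circ> Gamma) ?x + 1 / 2 * (ln \<circ> Gamma) (?x + 1)"
    using x by (intro convex_onD[OF log_convex_Gamma_real]) auto
  then have "2 * ln (Gamma ((real L + 1) / 2)) \<le> ln (Gamma ?x) + ln (Gamma (?x + 1))"
    by (simp add: add_divide_distrib)
  also have "\<dots> = ln (Gamma ?x * Gamma (?x + 1))"
    using Gamma_real_pos[of ?x] Gamma_real_pos[of "?x + 1"] x by (simp add: ln_mult_pos)
  also have "2 * ln (Gamma ((real L + 1) / 2)) = ln ((Gamma ((real L + 1) / 2))\<^sup>2)"
    by (simp add: ln_realpow Gamma_real_pos)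
  finally have "(Gamma ((real L + 1) / 2))\<^sup>2 \<le> Gamma ?x * Gamma (?x + 1)"
    by (simp only: ln_le_cancel_iff pos)
  also have "\<dots> = ?x * (Gamma ?x)\<^sup>2"
    using x by (subst Gamma_plus1) (auto simp: power2_eq_square elim!: nonpos_Ints_cases)
  finally have "2 * (Gamma ((real L + 1) / 2))\<^sup>2 / (Gamma ?x)\<^sup>2 \<le> L"
    using Gamma_real_pos[OF x] by (simp add: pos_divide_le_eq)
  then have "(A_const L)\<^sup>2 \<le> L" by (simp add: A_const_def power_mult_distrib power_divide)
  then show ?thesis by (rule real_le_rsqrt)
qed

text \<open>The deterministic part: the net bound controls the operator norm of the row-normalised
  matrix, and the smallness of the pseudoinverse vectors then makes that matrix a dual
  certificate.\<close>

lemma unique_l21_solution_if_net_bound: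
  assumes sub: "S \<subseteq> {..<N}" and rank: "full_col_rank_on A n S"
    and \<sigma>: "\<forall>j\<in>S. \<sigma> j > 0" and "L > 0"
    and small: "\<forall>l\<in>{..<N} - S. norm2S S (pinvS_apply A n S (\<lambda>i. A i l))
        < A_const L / (3 * sqrt (real L) + 2 * sqrt (real (card S)))"
    and net: "\<And>z. z \<in> lattice_net L \<Longrightarrow> 0 < (\<Sum>l<L. (real_of_int (z l))\<^sup>2) \<Longrightarrow>
      normalized_form S L (\<lambda>l. real_of_int (z l)) \<Phi>
       \<le> 3 / 4 * (9 + 4 * real (card S) / real L) * (\<Sum>l<L. (real_of_int (z l))\<^sup>2)"
  shows "unique_l21_solution A n N L (X_of S \<sigma> \<Phi>)"
proof -
  have fin: "finite S" using sub finite_subset by blast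
  define k where "k = real (card S)"
  define \<beta> where "\<beta> = 9 + 4 * k / real L"
  have "\<beta> > 0" by (simp add: \<beta>_def k_def add_pos_nonneg)
  define W where "W = (\<lambda>j. \<Sum>l<L. (\<Phi> (j, l))\<^sup>2)"
  have W0: "W j \<ge> 0" for j by (simp add: W_def sum_nonneg)
  \<comment> \<open>For a zero row of \<Phi>, division by zero gives a zero row of \<open>U\<close>;
    the row of \<open>X\<close> is zero too, so the certificate conditions persist.\<close>
  define U where "U = (\<lambda>j l. \<Phi> (j, l) / sqrt (W j))"
  have nf: "(\<Sum>j\<in>S. (\<Sum>l<L. U j l * z l)\<^sup>2) = normalized_form S L z \<Phi>" for z
  proof -
    have "(\<Sum>l<L. U j l * z l)\<^sup>2 = (\<Sum>l<L. z l * \<Phi> (j, l))\<^sup>2 / W j" for j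
    proof -
      have "(\<Sum>l<L. U j l * z l) = (\<Sum>l<L. z l * \<Phi> (j, l)) / sqrt (W j)"
        by (simp add: U_def sum_divide_distrib mult.commute)
      then show ?thesis using W0 by (simp add: power_divide)
    qed
    then show ?thesis by (simp add: normalized_form_def W_def)
  qed
  have op: "(\<Sum>l<L. (\<Sum>j\<in>S. U j l * x j)\<^sup>2) \<le> \<beta> * (\<Sum>j\<in>S. (x j)\<^sup>2)" for x
  proof (rule transpose_operator_norm_le)
    show "(\<Sum>j\<in>S. (\<Sum>l<L. U j l * x l)\<^sup>2) \<le> \<beta> * (\<Sum>l<L. (x l)\<^sup>2)" for x
      by (rule operator_norm_le_of_net[OF \<open>L > 0\<close>])
        (use \<open>\<beta> > 0\<close> net in \<open>auto simp: nf \<beta>_def k_def\<close>)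
  qed (use \<open>\<beta> > 0\<close> in simp)
  show ?thesis
  proof (rule unique_l21_solution_dual_certificate[OF rank sub, where U = U])
    show "X_of S \<sigma> \<Phi> j l = 0" if "j \<notin> S" for j l using that by (simp add: X_of_def)
    show "(\<Sum>l<L. (U j l)\<^sup>2) \<le> 1" for j
    proof -
      have "(U j l)\<^sup>2 = (\<Phi> (j, l))\<^sup>2 / W j" for l using W0 by (simp add: U_def power_divide)
      then have "(\<Sum>l<L. (U j l)\<^sup>2) = (\<Sum>l<L. (\<Phi> (j, l))\<^sup>2) / W j"
        by (simp only: sum_divide_distrib)
      also have "\<dots> = W j / W j" by (simp only: W_def)
      finally show ?thesis by simp
    qed
    show "(\<Sum>l<L. complex_of_real (U j l) * X_of S \<sigma> \<Phi> j l) = complex_of_real (vnorm L (X_of S \<sigma> \<Phi> j))" if "j \<in> S" for j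
    proof -
      have \<sigma>j: "\<sigma> j > 0" using \<sigma> that by simp
      have "(\<Sum>l<L. complex_of_real (U j l) * X_of S \<sigma> \<Phi> j l) = complex_of_real (\<Sum>l<L. U j l * (\<sigma> j * \<Phi> (j, l)))"
        using that by (simp add: X_of_def)
      also have "(\<Sum>l<L. U j l * (\<sigma> j * \<Phi> (j, l))) = \<sigma> j * (W j / sqrt (W j))"
        by (simp add: U_def W_def sum_divide_distrib sum_distrib_left power2_eq_square mult_ac)
      also have "W j / sqrt (W j) = sqrt (W j)" using W0 by (simp add: real_div_sqrt)
      also have "\<sigma> j * sqrt (W j) = vnorm L (X_of S \<sigma> \<Phi> j)"
      proof -
        have "(\<Sum>l<L. (cmod (X_of S \<sigma> \<Phi> j l))\<^sup>2) = (\<sigma> j)\<^sup>2 * W j"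
          using that by (simp add: X_of_def W_def norm_mult power_mult_distrib sum_distrib_left del: of_real_mult)
        then show ?thesis using \<sigma>j by (simp add: vnorm_def real_sqrt_mult)
      qed
      finally show ?thesis .
    qed
    fix m assume m: "m \<in> {..<N} - S"
    define c where "c = pinvS_apply A n S (\<lambda>i. A i m)"
    define \<gamma> where "\<gamma> = A_const L / (3 * sqrt (real L) + 2 * sqrt k)"
    \<comment> \<open>\<open>U\<close> is real and \<open>c\<close> complex, so the operator bound
      is applied to real and imaginary parts separately.\<close>
    have "(\<Sum>l<L. (cmod (\<Sum>j\<in>S. complex_of_real (U j l) * c j))\<^sup>2)
       = (\<Sum>l<L. (\<Sum>j\<in>S. U j l * Re (c j))\<^sup>2) + (\<Sum>l<L. (\<Sum>j\<in>S. U j l * Im (c j))\<^sup>2)"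
      by (simp add: cmod_power2 sum.distrib)
    also have "\<dots> \<le> \<beta> * (\<Sum>j\<in>S. (Re (c j))\<^sup>2) + \<beta> * (\<Sum>j\<in>S. (Im (c j))\<^sup>2)"
      by (intro add_mono op)
    also have "\<dots> = \<beta> * (norm2S S c)\<^sup>2"
      by (simp add: norm2S_def sum_nonneg cmod_power2 sum.distrib distrib_left)
    also have "\<dots> < \<beta> * \<gamma>\<^sup>2"
      using small m \<open>\<beta> > 0\<close>
      by (intro mult_strict_left_mono power_strict_mono) (auto simp: c_def \<gamma>_def k_def norm2S_def sum_nonneg)
    also have "\<dots> \<le> 1"
    proof -
      let ?D = "3 * sqrt (real L) + 2 * sqrt k"
      have D: "?D > 0" using \<open>L > 0\<close> by (simp add: add_pos_nonneg k_def)
      \<comment> \<open>Here \<gamma> meets \<beta>: \<open>\<beta> * L\<close> is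
        \<open>9 * L + 4 * k\<close>, which is \<open>?D\<^sup>2\<close> without its cross
        term.\<close>
      have "\<beta> * (A_const L)\<^sup>2 \<le> \<beta> * L"
        using A_const_le_sqrt[OF \<open>L > 0\<close>] A_const_pos[OF \<open>L > 0\<close>] \<open>\<beta> > 0\<close>
        by (intro mult_left_mono) (auto simp: sqrt_ge_absD)
      also have "\<dots> = 9 * L + 4 * k" using \<open>L > 0\<close> by (simp add: \<beta>_def field_simps)
      also have "\<dots> \<le> ?D\<^sup>2"
        by (simp add: power2_sum power_mult_distrib k_def)
      finally show ?thesis using D by (simp add: \<gamma>_def power_divide divide_le_eq_1)
    qed
    finally show "vnorm L (\<lambda>l. \<Sum>j\<in>S. complex_of_real (U j l) * pinvS_apply A n S (\<lambda>i. A i m) j) < 1"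
      by (simp add: vnorm_def c_def)
  qed
qed

theorem theorem4:
  fixes A :: "nat \<Rightarrow> nat \<Rightarrow> complex" and n N L k :: nat and S :: "nat set"
    and \<sigma> :: "nat \<Rightarrow> real"
  assumes "S \<subseteq> {..<N}" and "card S = k"
    and "full_col_rank_on A n S"
    and "\<forall>j\<in>S. \<sigma> j > 0"
    and "L > 0"
    and "\<forall>l\<in>{..<N} - S.
           norm2S S (pinvS_apply A n S (\<lambda>i. A i l)) < A_const L / (3 * sqrt (real L) + 2 * sqrt (real k))"
  shows "measure (gauss_entries S L)
            {\<Phi> \<in> space (gauss_entries S L). unique_l21_solution A n N L (X_of S \<sigma> \<Phi>)}
         \<ge> 1 - exp (- real L / 8) - real k * exp (- (A_const L)\<^sup>2 / 8)"
proof -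
  let ?M = "gauss_entries S L"
  interpret prob_space ?M by (rule prob_space_gauss_entries)
  have fin: "finite S" using assms(1) finite_subset by blast
  define G where "G = {\<Phi> \<in> space ?M. unique_l21_solution A n N L (X_of S \<sigma> \<Phi>)}"
  define B where "B = {\<Phi> \<in> space ?M. \<exists>z\<in>lattice_net L. 0 < (\<Sum>l<L. (real_of_int (z l))\<^sup>2) \<and>
      3 / 4 * (9 + 4 * real (card S) / real L) * (\<Sum>l<L. (real_of_int (z l))\<^sup>2)
        < normalized_form S L (\<lambda>l. real_of_int (z l)) \<Phi>}"
  have G: "G \<in> sets ?M" unfolding G_def by (rule unique_l21_solution_event)
  have B: "B \<in> sets ?M" unfolding B_def
    using finite_lattice_net[of L] by measurable
  \<comment> \<open>Off \<open>B\<close> recovery is deterministic, so all of the failure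
    probability sits in \<open>B\<close>.\<close>
  have "space ?M - B \<subseteq> G"
  proof
    fix \<Phi> assume \<Phi>: "\<Phi> \<in> space ?M - B"
    have "unique_l21_solution A n N L (X_of S \<sigma> \<Phi>)"
      by (rule unique_l21_solution_if_net_bound[OF assms(1,3,4,5)])
        (use \<Phi> assms(2,6) in \<open>force simp: B_def not_less\<close>)+
    then show "\<Phi> \<in> G" using \<Phi> by (simp add: G_def)
  qed
  then have "prob (space ?M - B) \<le> prob G" using G by (rule finite_measure_mono)
  moreover have "prob (space ?M - B) = 1 - prob B" using B by (rule prob_compl)
  moreover have "prob B \<le> exp (- real L / 8)"
    unfolding B_def by (rule normalized_form_net_tail[OF fin assms(5)])
  \<comment> \<open>Failure already has probability at most \<open>exp (- L / 8)\<close>;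
    subtracting this nonnegative term weakens the estimate to the stated form.\<close>
  moreover have "0 \<le> real k * exp (- (A_const L)\<^sup>2 / 8)" by simp
  ultimately show ?thesis unfolding G_def by linarith
qed

end
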